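(* Let $M$ be a quaternionic manifold of real dimension $4n$. For $0\le k\le 4n$, the decomposition into irreducibles of the induced representation of $\mathrm{Sp}(1)$ on (the fibres of) $\Lambda^kT^*M$ is $$\Lambda^kT^*M\cong\bigoplus_{\substack{0\le r\le k\\ r\equiv k \bmod 2}}\left[\binom{2n}{\frac{k+r}{2}}\binom{2n}{\frac{k-r}{2}}-\binom{2n}{\frac{k+r+2}{2}}\binom{2n}{\frac{k-r-2}{2}}\right]V_r .$$
   Context: Binomial coefficients $\binom{p}{q}$ with $q<0$ or $q>p$ are zero. $V_r=S^r(\mathbb{C}^2)$ is the irreducible complex representation of $\mathrm{Sp}(1)\cong\mathrm{SU}(2)$ of dimension $r+1$ (highest weight $r$); an integer coefficient in front of $V_r$ denotes multiplicity. As is conventional, $\Lambda^kT^*M$ is complexified when it is decomposed into complex representations. A quaternionic manifold is, for $n\ge 2$, a real $4n$-manifold $M$ with an $\mathrm{Sp}(1)\mathrm{GL}(n,\mathbb{H})$-structure $Q$ admitting a torsion-free connection; here $\mathrm{Sp}(1)\mathrm{GL}(n,\mathbb{H})=\mathrm{Sp}(1)\times_{\mathbb{Z}_2}\mathrm{GL}(n,\mathbb{H})\subset \mathrm{GL}(4n,\mathbb{R})$ acts on $\mathbb{H}^n$, with $\mathrm{Sp}(1)$ the unit quaternions acting by left multiplication and $\mathrm{GL}(n,\mathbb{H})$ acting by right multiplication by quaternionic matrices. For $n=1$ a quaternionic manifold means a self-dual conformal 4-manifold (with the induced $\mathrm{Sp}(1)\mathrm{GL}(1,\mathbb{H})$-structure).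 The structure gives locally defined almost complex structures $I,J,K$ with $IJ=K$, well defined up to rotation. They act on $T^*M$ (with $IJ=K$ there too), giving an action of the Lie algebra $\mathfrak{sp}(1)=\langle I,J,K\rangle$, and hence of $\mathrm{Sp}(1)$, on each $T^*_xM\cong\mathbb{H}^n$. It is extended to $\Lambda^kT^*_xM$ as a group action (equivalently by derivations for $\mathfrak{sp}(1)$). The isomorphism type of this representation does not depend on the choice of $I,J,K$. *)

theory Defs
  imports "HOL-Analysis.Analysis" "HOL-Library.Function_Algebras"
begin

section \<open>Quaternions and the group Sp(1)GL(n,H)\<close>

(* The pair (a, b) is the quaternion a + b j, with j z = cnj z j for complex z. Norm and inner
   product of the product type are the Euclidean ones of H = R^4. *)
type_synonym quat = "complex \<times> complex"

definition qmult :: "quat \<Rightarrow> quat \<Rightarrow> quat" where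
  "qmult p q = (fst p * fst q - snd p * cnj (snd q), fst p * snd q + snd p * cnj (fst q))"

definition qcnj :: "quat \<Rightarrow> quat" where
  "qcnj q = (cnj (fst q), - snd q)"

definition q_one :: quat where "q_one = (1, 0)"
definition q_i :: quat where "q_i = (\<i>, 0)"
definition q_j :: quat where "q_j = (0, 1)"
definition q_k :: quat where "q_k = (0, \<i>)"

lemma quaternion_relations:
  "qmult q_i q_j = q_k" "qmult q_j q_k = q_i" "qmult q_k q_i = q_j" "qmult q_j q_i = - q_k"
  "qmult q_i q_i = - q_one" "qmult q_j q_j = - q_one" "qmult q_k q_k = - q_one"
  by (simp_all add: qmult_def q_one_def q_i_def q_j_def q_k_def zero_prod_def)

definition Sp1 :: "quat set" where
  "Sp1 = {q. norm q = 1}"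

lemma qmult_qcnj:
  assumes "q \<in> Sp1"
  shows "qmult q (qcnj q) = q_one" "qmult (qcnj q) q = q_one"
proof -
  have "(norm (fst q))\<^sup>2 + (norm (snd q))\<^sup>2 = 1"
    using assms by (simp add: Sp1_def norm_prod_def)
  then have "complex_of_real ((norm (fst q))\<^sup>2 + (norm (snd q))\<^sup>2) = 1"
    by simp
  then have "fst q * cnj (fst q) + snd q * cnj (snd q) = 1"
    by (simp add: complex_norm_square[symmetric] flip: of_real_power)
  then show "qmult q (qcnj q) = q_one" "qmult (qcnj q) q = q_one"
    by (simp_all add: qmult_def qcnj_def q_one_def algebra_simps)
qed

definition qleft :: "quat \<Rightarrow> quat ^ 'n \<Rightarrow> quat ^ 'n" where
  "qleft q h = (\<chi> l. qmult q (h $ l))"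

definition qright :: "quat ^ 'n \<Rightarrow> quat ^ 'n ^ 'n \<Rightarrow> quat ^ 'n" where
  "qright h B = (\<chi> l. \<Sum>m\<in>UNIV. qmult (h $ m) (B $ m $ l))"

definition qmat_mult :: "quat ^ 'n ^ 'n \<Rightarrow> quat ^ 'n ^ 'n \<Rightarrow> quat ^ 'n ^ 'n" where
  "qmat_mult B C = (\<chi> l m. \<Sum>s\<in>UNIV. qmult (B $ l $ s) (C $ s $ m))"

definition qmat_one :: "quat ^ 'n ^ 'n" where
  "qmat_one = (\<chi> l m. if l = m then q_one else 0)"

definition GLnH :: "(quat ^ 'n ^ 'n) set" where
  "GLnH = {B. \<exists>C. qmat_mult B C = qmat_one \<and> qmat_mult C B = qmat_one}"

definition Sp1GLnH :: "(quat ^ 'n \<Rightarrow> quat ^ 'n) set" where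
  "Sp1GLnH = {g. \<exists>q\<in>Sp1. \<exists>B\<in>GLnH. g = (\<lambda>h. qleft q (qright h B))}"

(* The Lie algebra sp(1) + gl(n,H) of Sp1GLnH; sp(1) consists of the imaginary quaternions. *)
definition sp1_gl_nH :: "(quat ^ 'n \<Rightarrow> quat ^ 'n) set" where
  "sp1_gl_nH = {g. \<exists>q B. Re (fst q) = 0 \<and> g = (\<lambda>h. qleft q h + qright h B)}"

section \<open>Smooth manifolds modelled on H^n\<close>

(* C^m and smooth maps on an open set. *)
primrec Ck_on :: "nat \<Rightarrow> ('a::euclidean_space \<Rightarrow> 'b::real_normed_vector) \<Rightarrow> 'a set \<Rightarrow> bool" where
  "Ck_on 0 f S \<longleftrightarrow> continuous_on S f"
| "Ck_on (Suc m) f S \<longleftrightarrow> (\<forall>p\<in>S. f differentiable (at p)) \<and>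
     (\<forall>v. Ck_on m (\<lambda>p. frechet_derivative f (at p) v) S)"

definition smooth_on :: "('a::euclidean_space \<Rightarrow> 'b::real_normed_vector) \<Rightarrow> 'a set \<Rightarrow> bool" where
  "smooth_on f S \<longleftrightarrow> (\<forall>m. Ck_on m f S)"

(* A chart (U, \<phi>): only the values of \<phi> on U matter. *)
type_synonym ('m, 'n) chart = "'m set \<times> ('m \<Rightarrow> quat ^ 'n)"

definition chart_inv :: "('m, 'n::finite) chart \<Rightarrow> quat ^ 'n \<Rightarrow> 'm" where
  "chart_inv c = inv_into (fst c) (snd c)"

definition chart_range :: "('m, 'n::finite) chart \<Rightarrow> (quat ^ 'n) set" where
  "chart_range c = snd c ` fst c"

definition transition ::
  "('m, 'n::finite) chart \<Rightarrow> ('m, 'n) chart \<Rightarrow> quat ^ 'n \<Rightarrow> quat ^ 'n" where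
  "transition c c' = snd c' \<circ> chart_inv c"

definition smooth_manifold :: "'m topology \<Rightarrow> ('m, 'n::finite) chart set \<Rightarrow> bool" where
  "smooth_manifold X \<A> \<longleftrightarrow>
     Hausdorff_space X \<and> second_countable X \<and>
     (\<Union>c\<in>\<A>. fst c) = topspace X \<and>
     (\<forall>c\<in>\<A>. openin X (fst c) \<and> open (chart_range c) \<and>
        homeomorphic_map (subtopology X (fst c)) (top_of_set (chart_range c)) (snd c)) \<and>
     (\<forall>c\<in>\<A>. \<forall>c'\<in>\<A>. smooth_on (transition c c') (snd c ` (fst c \<inter> fst c')))"

(* A tangent vector at x is the family of its coordinate vectors in the charts around x, any two
   of them related by the derivative of the transition map. Vector space operations are pointwise. *)
type_synonym ('m, 'n) tvec = "('m, 'n) chart \<Rightarrow> quat ^ 'n"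

definition tangent_space ::
  "('m, 'n::finite) chart set \<Rightarrow> 'm \<Rightarrow> ('m, 'n) tvec set" where
  "tangent_space \<A> x = {v.
     (\<forall>c. c \<notin> \<A> \<or> x \<notin> fst c \<longrightarrow> v c = 0) \<and>
     (\<forall>c\<in>\<A>. \<forall>c'\<in>\<A>. x \<in> fst c \<inter> fst c' \<longrightarrow>
        v c' = frechet_derivative (transition c c') (at (snd c x)) (v c))}"

definition tscale :: "real \<Rightarrow> ('m, 'n::finite) tvec \<Rightarrow> ('m, 'n) tvec" where
  "tscale a v = (\<lambda>c. a *\<^sub>R v c)"

(* The tangent vector at the point with coordinates p in the chart c whose c-coordinates are e. *)
definition coord_tvec ::
  "('m, 'n::finite) chart set \<Rightarrow> ('m, 'n) chart \<Rightarrow> quat ^ 'n \<Rightarrow> quat ^ 'n \<Rightarrow> ('m, 'n) tvec" where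
  "coord_tvec \<A> c p e = (\<lambda>c'. if c' \<in> \<A> \<and> chart_inv c p \<in> fst c'
      then frechet_derivative (transition c c') (at p) e else 0)"

section \<open>Sp(1)GL(n,H)-structures\<close>

(* Linear isomorphisms T \<rightarrow> H^n; extensional, so that they are determined by their values on T. *)
definition coframes :: "('m, 'n::finite) tvec set \<Rightarrow> (('m, 'n) tvec \<Rightarrow> quat ^ 'n) set" where
  "coframes T = {u \<in> extensional T. bij_betw u T UNIV \<and>
     (\<forall>v\<in>T. \<forall>w\<in>T. u (v + w) = u v + u w) \<and>
     (\<forall>a. \<forall>v\<in>T. u (tscale a v) = a *\<^sub>R u v)}"

definition coord_coframe ::
  "('m, 'n::finite) chart set \<Rightarrow> ('m \<Rightarrow> ('m, 'n) tvec \<Rightarrow> quat ^ 'n) \<Rightarrow> ('m, 'n) chart \<Rightarrow>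
     quat ^ 'n \<Rightarrow> quat ^ 'n \<Rightarrow> quat ^ 'n" where
  "coord_coframe \<A> s c p e = s (chart_inv c p) (coord_tvec \<A> c p e)"

definition local_section ::
  "'m topology \<Rightarrow> ('m, 'n::finite) chart set \<Rightarrow> ('m \<Rightarrow> (('m, 'n) tvec \<Rightarrow> quat ^ 'n) set) \<Rightarrow>
     ('m, 'n) chart \<Rightarrow> 'm set \<Rightarrow> ('m \<Rightarrow> ('m, 'n) tvec \<Rightarrow> quat ^ 'n) \<Rightarrow> bool" where
  "local_section X \<A> Q c U s \<longleftrightarrow>
     openin X U \<and> U \<subseteq> fst c \<and> (\<forall>y\<in>U. s y \<in> Q y) \<and>
     (\<forall>e. smooth_on (\<lambda>p. coord_coframe \<A> s c p e) (snd c ` U))"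

(* Q x is the fibre over x of a smooth principal subbundle of the bundle of coframes
   T_xM \<rightarrow> H^n, with group Sp1GLnH acting by composition. *)
definition Sp1GLnH_structure ::
  "'m topology \<Rightarrow> ('m, 'n::finite) chart set \<Rightarrow> ('m \<Rightarrow> (('m, 'n) tvec \<Rightarrow> quat ^ 'n) set) \<Rightarrow> bool"
  where
  "Sp1GLnH_structure X \<A> Q \<longleftrightarrow>
     (\<forall>x\<in>topspace X. Q x \<noteq> {} \<and> Q x \<subseteq> coframes (tangent_space \<A> x) \<and>
        (\<forall>u\<in>Q x. \<forall>u'\<in>coframes (tangent_space \<A> x).
           u' \<in> Q x \<longleftrightarrow> (\<exists>g\<in>Sp1GLnH. \<forall>v\<in>tangent_space \<A> x. u' v = g (u v)))) \<and>
     (\<forall>c\<in>\<A>. \<forall>x\<in>fst c. \<exists>U s. x \<in> U \<and> local_section X \<A> Q c U s)"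

section \<open>Connections and curvature\<close>

(* Christoffel symbols: \<Gamma> c p v w is the value at p of the covariant derivative, along v, of the
   vector field that is constantly w in the coordinates c. *)
type_synonym ('m, 'n) christoffel =
  "('m, 'n) chart \<Rightarrow> quat ^ 'n \<Rightarrow> quat ^ 'n \<Rightarrow> quat ^ 'n \<Rightarrow> quat ^ 'n"

definition affine_connection ::
  "('m, 'n::finite) chart set \<Rightarrow> ('m, 'n) christoffel \<Rightarrow> bool" where
  "affine_connection \<A> \<Gamma> \<longleftrightarrow>
     (\<forall>c\<in>\<A>. (\<forall>p\<in>chart_range c. bilinear (\<Gamma> c p)) \<and>
        (\<forall>v w. smooth_on (\<lambda>p. \<Gamma> c p v w) (chart_range c))) \<and>
     (\<forall>c\<in>\<A>. \<forall>c'\<in>\<A>. \<forall>p \<in> snd c ` (fst c \<inter> fst c'). \<forall>v w.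
        let \<tau> = transition c c'; D = frechet_derivative \<tau> (at p) in
          \<Gamma> c' (\<tau> p) (D v) (D w) =
            D (\<Gamma> c p v w) - frechet_derivative (\<lambda>p'. frechet_derivative \<tau> (at p') w) (at p) v)"

definition torsion_free ::
  "('m, 'n::finite) chart set \<Rightarrow> ('m, 'n) christoffel \<Rightarrow> bool" where
  "torsion_free \<A> \<Gamma> \<longleftrightarrow> (\<forall>c\<in>\<A>. \<forall>p\<in>chart_range c. \<forall>v w. \<Gamma> c p v w = \<Gamma> c p w v)"

(* The connection reduces to Q: for every local section s of Q, the covariant derivative of s
   along any v is a Lie algebra element applied to s. *)
definition preserves_structure ::
  "'m topology \<Rightarrow> ('m, 'n::finite) chart set \<Rightarrow> ('m \<Rightarrow> (('m, 'n) tvec \<Rightarrow> quat ^ 'n) set) \<Rightarrow>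
     ('m, 'n) christoffel \<Rightarrow> bool" where
  "preserves_structure X \<A> Q \<Gamma> \<longleftrightarrow>
     (\<forall>c\<in>\<A>. \<forall>U s. local_section X \<A> Q c U s \<longrightarrow> (\<forall>p \<in> snd c ` U. \<forall>v.
        \<exists>\<xi>\<in>sp1_gl_nH. \<forall>w.
          frechet_derivative (\<lambda>p'. coord_coframe \<A> s c p' w) (at p) v
            - coord_coframe \<A> s c p (\<Gamma> c p v w) = \<xi> (coord_coframe \<A> s c p w)))"

(* R(v,w)z at the point with coordinates p in the chart c. *)
definition curvature ::
  "('m, 'n::finite) christoffel \<Rightarrow> ('m, 'n) chart \<Rightarrow> quat ^ 'n \<Rightarrow>
     quat ^ 'n \<Rightarrow> quat ^ 'n \<Rightarrow> quat ^ 'n \<Rightarrow> quat ^ 'n" where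
  "curvature \<Gamma> c p v w z =
     frechet_derivative (\<lambda>p'. \<Gamma> c p' w z) (at p) v - frechet_derivative (\<lambda>p'. \<Gamma> c p' v z) (at p) w
     + \<Gamma> c p v (\<Gamma> c p w z) - \<Gamma> c p w (\<Gamma> c p v z)"

definition ricci :: "('a::euclidean_space \<Rightarrow> 'a \<Rightarrow> 'a \<Rightarrow> 'a) \<Rightarrow> 'a \<Rightarrow> 'a \<Rightarrow> real" where
  "ricci R w z = (\<Sum>b\<in>Basis. R b w z \<bullet> b)"

(* Scalar curvature, computed in the h-orthogonal frame (f b), b \<in> Basis. *)
definition scalar_curvature ::
  "('a::euclidean_space \<Rightarrow> 'a \<Rightarrow> real) \<Rightarrow> ('a \<Rightarrow> 'a \<Rightarrow> 'a \<Rightarrow> 'a) \<Rightarrow> ('a \<Rightarrow> 'a) \<Rightarrow> real" where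
  "scalar_curvature h R f = (\<Sum>b\<in>Basis. ricci R (f b) (f b) / h (f b) (f b))"

(* The Weyl tensor of the metric h with curvature R in dimension 4, all indices lowered. *)
definition weyl4 ::
  "('a::euclidean_space \<Rightarrow> 'a \<Rightarrow> real) \<Rightarrow> ('a \<Rightarrow> 'a \<Rightarrow> 'a \<Rightarrow> 'a) \<Rightarrow> ('a \<Rightarrow> 'a) \<Rightarrow>
     'a \<Rightarrow> 'a \<Rightarrow> 'a \<Rightarrow> 'a \<Rightarrow> real" where
  "weyl4 h R f v w z t = h (R v w z) t
     - (ricci R w z * h v t + h w z * ricci R v t - ricci R v z * h w t - h v z * ricci R w t) / 2
     + scalar_curvature h R f / 6 * (h w z * h v t - h v z * h w t)"

section \<open>Quaternionic manifolds\<close>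

definition coord_metric ::
  "('m, 'n::finite) chart set \<Rightarrow> ('m \<Rightarrow> ('m, 'n) tvec \<Rightarrow> ('m, 'n) tvec \<Rightarrow> real) \<Rightarrow>
     ('m, 'n) chart \<Rightarrow> quat ^ 'n \<Rightarrow> quat ^ 'n \<Rightarrow> quat ^ 'n \<Rightarrow> real" where
  "coord_metric \<A> g c p v w = g (chart_inv c p) (coord_tvec \<A> c p v) (coord_tvec \<A> c p w)"

(* For n = 1, where Sp1GLnH is the group of orientation preserving conformal linear maps of H,
   the coframes in Q are the oriented conformal ones of the metric g; being pointwise a multiple
   of a pulled back inner product, g is automatically a metric. *)
definition compatible_metric ::
  "'m topology \<Rightarrow> ('m, 'n::finite) chart set \<Rightarrow> ('m \<Rightarrow> (('m, 'n) tvec \<Rightarrow> quat ^ 'n) set) \<Rightarrow>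
     ('m \<Rightarrow> ('m, 'n) tvec \<Rightarrow> ('m, 'n) tvec \<Rightarrow> real) \<Rightarrow> bool" where
  "compatible_metric X \<A> Q g \<longleftrightarrow>
     (\<forall>x\<in>topspace X. \<forall>u\<in>Q x. \<exists>a>0. \<forall>v\<in>tangent_space \<A> x. \<forall>w\<in>tangent_space \<A> x.
        g x v w = a * (u v \<bullet> u w)) \<and>
     (\<forall>c\<in>\<A>. \<forall>v w. smooth_on (\<lambda>p. coord_metric \<A> g c p v w) (chart_range c))"

definition levi_civita ::
  "('m, 'n::finite) chart set \<Rightarrow> ('m \<Rightarrow> ('m, 'n) tvec \<Rightarrow> ('m, 'n) tvec \<Rightarrow> real) \<Rightarrow>
     ('m, 'n) christoffel \<Rightarrow> bool" where
  "levi_civita \<A> g \<Gamma> \<longleftrightarrow> affine_connection \<A> \<Gamma> \<and> torsion_free \<A> \<Gamma> \<and>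
     (\<forall>c\<in>\<A>. \<forall>p\<in>chart_range c. \<forall>v w z.
        frechet_derivative (\<lambda>p'. coord_metric \<A> g c p' w z) (at p) v =
          coord_metric \<A> g c p (\<Gamma> c p v w) z + coord_metric \<A> g c p w (\<Gamma> c p v z))"

(* The Weyl tensor W is self-dual, i.e. *W = W for the Hodge star on 2-forms, if
   W(e0,e1) = W(e2,e3) for all positively oriented conformal frames e0,e1,e2,e3. The orientation
   is the usual one of quaternionic geometry, in which the 2-forms of the almost complex
   structures I, J, K are anti-self-dual: the frame sent by a coframe in Q to 1, i, k, j is
   positively oriented, since I, J, K act by left multiplication on H. *)
definition self_dual_conformal_structure ::
  "'m topology \<Rightarrow> ('m, 'n::finite) chart set \<Rightarrow> ('m \<Rightarrow> (('m, 'n) tvec \<Rightarrow> quat ^ 'n) set) \<Rightarrow> bool"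
  where
  "self_dual_conformal_structure X \<A> Q \<longleftrightarrow>
     (\<exists>g \<Gamma>. compatible_metric X \<A> Q g \<and> levi_civita \<A> g \<Gamma> \<and>
        (\<forall>c\<in>\<A>. \<forall>x\<in>fst c. \<forall>u\<in>Q x. \<forall>z t.
           let p = snd c x;
               f = inv (\<lambda>e. u (coord_tvec \<A> c p e));
               e = (\<lambda>q. f (\<chi> l. q));
               W = weyl4 (coord_metric \<A> g c p) (curvature \<Gamma> c p) f
           in W (e q_one) (e q_i) z t = W (e q_k) (e q_j) z t))"

definition quaternionic_manifold ::
  "'m topology \<Rightarrow> ('m, 'n::finite) chart set \<Rightarrow> ('m \<Rightarrow> (('m, 'n) tvec \<Rightarrow> quat ^ 'n) set) \<Rightarrow> bool"
  where
  "quaternionic_manifold X \<A> Q \<longleftrightarrow>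
     smooth_manifold X \<A> \<and> Sp1GLnH_structure X \<A> Q \<and>
     (if CARD('n) = 1 then self_dual_conformal_structure X \<A> Q
      else \<exists>\<Gamma>. affine_connection \<A> \<Gamma> \<and> torsion_free \<A> \<Gamma> \<and> preserves_structure X \<A> Q \<Gamma>)"

section \<open>Complex representations of Sp(1)\<close>

(* All representations below live on complex vector spaces of complex-valued functions. *)
definition fscale :: "complex \<Rightarrow> ('x \<Rightarrow> complex) \<Rightarrow> 'x \<Rightarrow> complex" where
  "fscale a f = (\<lambda>y. a * f y)"

definition Sp1_rep ::
  "('x \<Rightarrow> complex) set \<Rightarrow> (quat \<Rightarrow> ('x \<Rightarrow> complex) \<Rightarrow> 'x \<Rightarrow> complex) \<Rightarrow> bool" where
  "Sp1_rep V \<rho> \<longleftrightarrow> module.subspace fscale V \<and>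
     (\<forall>q\<in>Sp1. \<forall>f\<in>V. \<rho> q f \<in> V) \<and>
     (\<forall>q\<in>Sp1. \<forall>f\<in>V. \<forall>g\<in>V. \<rho> q (f + g) = \<rho> q f + \<rho> q g) \<and>
     (\<forall>q\<in>Sp1. \<forall>a. \<forall>f\<in>V. \<rho> q (fscale a f) = fscale a (\<rho> q f)) \<and>
     (\<forall>f\<in>V. \<rho> q_one f = f) \<and>
     (\<forall>q\<in>Sp1. \<forall>q'\<in>Sp1. \<forall>f\<in>V. \<rho> (qmult q q') f = \<rho> q (\<rho> q' f))"

definition Sp1_isomorphic ::
  "('x \<Rightarrow> complex) set \<Rightarrow> (quat \<Rightarrow> ('x \<Rightarrow> complex) \<Rightarrow> 'x \<Rightarrow> complex) \<Rightarrow>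
   ('y \<Rightarrow> complex) set \<Rightarrow> (quat \<Rightarrow> ('y \<Rightarrow> complex) \<Rightarrow> 'y \<Rightarrow> complex) \<Rightarrow> bool" where
  "Sp1_isomorphic V \<rho> W \<sigma> \<longleftrightarrow> Sp1_rep V \<rho> \<and> Sp1_rep W \<sigma> \<and>
     (\<exists>F. bij_betw F V W \<and>
        (\<forall>f\<in>V. \<forall>g\<in>V. F (f + g) = F f + F g) \<and>
        (\<forall>a. \<forall>f\<in>V. F (fscale a f) = fscale a (F f)) \<and>
        (\<forall>q\<in>Sp1. \<forall>f\<in>V. F (\<rho> q f) = \<sigma> q (F f)))"

(* The isomorphism Sp(1) \<rightarrow> SU(2), written here for all quaternions. *)
definition su2 :: "quat \<Rightarrow> complex ^ 2 ^ 2" where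
  "su2 q = vector [vector [fst q, snd q], vector [- cnj (snd q), cnj (fst q)]]"

lemma su2_qmult: "su2 (qmult p q) = su2 p ** su2 q"
  by (simp add: su2_def qmult_def matrix_matrix_mult_def vec_eq_iff forall_2 sum_2)

(* V_r = S^r(C^2): elements of S^r(C^2) are the homogeneous polynomials of degree r on the dual
   space, i.e. on row vectors \<zeta>. A column vector z is the linear polynomial \<zeta> \<mapsto> \<zeta> z, hence
   g in SU(2) acts by (g f) \<zeta> = f (\<zeta> g). *)
definition V_carrier :: "nat \<Rightarrow> (complex ^ 2 \<Rightarrow> complex) set" where
  "V_carrier r = {f. \<exists>a. f = (\<lambda>\<zeta>. \<Sum>i\<le>r. a i * (\<zeta> $ 1) ^ (r - i) * (\<zeta> $ 2) ^ i)}"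

definition V_action :: "quat \<Rightarrow> (complex ^ 2 \<Rightarrow> complex) \<Rightarrow> complex ^ 2 \<Rightarrow> complex" where
  "V_action q f = (\<lambda>\<zeta>. f (\<zeta> v* su2 q))"

(* The direct sum over r \<in> R (finite) of m r copies of V_r; the function f (r, j, -) is the
   component of f in the j-th copy of V_r. *)
definition V_sum_carrier :: "nat set \<Rightarrow> (nat \<Rightarrow> nat) \<Rightarrow> (nat \<times> nat \<times> (complex ^ 2) \<Rightarrow> complex) set" where
  "V_sum_carrier R m = {f. \<forall>r j.
     if r \<in> R \<and> j < m r then (\<lambda>\<zeta>. f (r, j, \<zeta>)) \<in> V_carrier r else (\<forall>\<zeta>. f (r, j, \<zeta>) = 0)}"

definition V_sum_action ::
  "quat \<Rightarrow> (nat \<times> nat \<times> (complex ^ 2) \<Rightarrow> complex) \<Rightarrow> nat \<times> nat \<times> (complex ^ 2) \<Rightarrow> complex" where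
  "V_sum_action q f = (\<lambda>(r, j, \<zeta>). V_action q (\<lambda>\<eta>. f (r, j, \<eta>)) \<zeta>)"

section \<open>The representation on exterior forms\<close>

(* The complexified k-th exterior power of the dual of T: alternating real-multilinear
   complex-valued forms on T, extended by 0 to lists which are not k-tuples of elements of T. *)
definition complex_forms ::
  "nat \<Rightarrow> ('m, 'n::finite) tvec set \<Rightarrow> (('m, 'n) tvec list \<Rightarrow> complex) set" where
  "complex_forms k T = {\<omega>.
     (\<forall>vs. \<not> (length vs = k \<and> set vs \<subseteq> T) \<longrightarrow> \<omega> vs = 0) \<and>
     (\<forall>vs i v w. length vs = k \<and> set vs \<subseteq> T \<and> i < k \<and> v \<in> T \<and> w \<in> T \<longrightarrow>
        \<omega> (vs[i := v + w]) = \<omega> (vs[i := v]) + \<omega> (vs[i := w])) \<and>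
     (\<forall>vs i v a. length vs = k \<and> set vs \<subseteq> T \<and> i < k \<and> v \<in> T \<longrightarrow>
        \<omega> (vs[i := tscale a v]) = of_real a * \<omega> (vs[i := v])) \<and>
     (\<forall>vs i j. length vs = k \<and> set vs \<subseteq> T \<and> i < j \<and> j < k \<and> vs ! i = vs ! j \<longrightarrow> \<omega> vs = 0)}"

(* Action of q = a + b i + c j + d k as a + b I + c J + d K on the tangent space T, where
   I, J, K correspond under the coframe u to left multiplication by i, j, k. *)
definition tangent_action ::
  "('m, 'n::finite) tvec set \<Rightarrow> (('m, 'n) tvec \<Rightarrow> quat ^ 'n) \<Rightarrow> quat \<Rightarrow> ('m, 'n) tvec \<Rightarrow> ('m, 'n) tvec"
  where
  "tangent_action T u q v = inv_into T u (qleft q (u v))"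

(* The contragredient action (q inverse is qcnj q on Sp1). On covectors this is
   I \<alpha> = - \<alpha> \<circ> I and likewise for J, K; the sign makes I J = K hold on the cotangent space too. *)
definition form_action ::
  "('m, 'n::finite) tvec set \<Rightarrow> (('m, 'n) tvec \<Rightarrow> quat ^ 'n) \<Rightarrow>
     quat \<Rightarrow> (('m, 'n) tvec list \<Rightarrow> complex) \<Rightarrow> ('m, 'n) tvec list \<Rightarrow> complex" where
  "form_action T u q \<omega> =
     (\<lambda>vs. if set vs \<subseteq> T then \<omega> (map (tangent_action T u (qcnj q)) vs) else 0)"

(* Binomial coefficients with integer lower entry, zero outside the range 0..p. *)
definition zbinom :: "nat \<Rightarrow> int \<Rightarrow> int" where
  "zbinom p q = (if q < 0 then 0 else int (p choose nat q))"

end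

theory Submission
  imports Defs
begin

text \<open>
  A coframe identifies a tangent space with \<open>H\<^sup>n\<close>, so the claim is one of linear algebra: only the
  fibrewise action of Sp(1) on \<open>H\<^sup>n\<close> by left multiplication matters. The complex-valued real-linear
  functionals on \<open>H\<^sup>n\<close> split into \<open>2n\<close> \<^emph>\<open>doublets\<close>: writing the \<open>l\<close>-th coordinate as \<open>z + w j\<close>, the pairs
  \<open>(cnj w, z)\<close> and \<open>(- cnj z, w)\<close> both transform like the standard basis of \<open>V\<^sub>1 = C\<^sup>2\<close>. Hence the exterior
  algebra is the tensor product of \<open>2n\<close> copies of \<open>\<Lambda> V\<^sub>1 = V\<^sub>0 + V\<^sub>1 + V\<^sub>0\<close> (degrees 0, 1, 2), and adding
  one doublet \<open>\<beta>1, \<beta>2\<close> to a set \<open>S\<close> of doublets gives, equivariantly,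
  \<open>\<Lambda>\<^sup>k(S + \<beta>) = \<Lambda>\<^sup>k(S) + \<beta>1 \<and> \<beta>2 \<and> \<Lambda>\<^sup>k\<^sup>-\<^sup>2(S) + V\<^sub>1 \<otimes> \<Lambda>\<^sup>k\<^sup>-\<^sup>1(S)\<close> (\<open>forms_on_insert\<close>).

  The subspaces \<open>\<Lambda>\<^sup>k(S)\<close> are realised inside the space of all alternating forms, as the forms killed by
  contraction with the complex vectors dual to the doublets outside \<open>S\<close>. Contractions also separate the
  summands. So the decomposition follows by induction on \<open>S\<close> from three closure properties of explicit
  decompositions: images (\<open>decomposes_image\<close>), direct sums (\<open>decomposes_direct_sum\<close>) and tensor products with
  \<open>V\<^sub>1\<close> (\<open>decomposes_tensor_V1\<close>). The last one is the Clebsch-Gordan rule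
  \<open>V\<^sub>r \<otimes> V\<^sub>1 = V\<^sub>r\<^sub>+\<^sub>1 + V\<^sub>r\<^sub>-\<^sub>1\<close>, given on binary forms by
  \<open>(h, g) \<mapsto> (\<partial>\<^sub>1h - \<zeta>\<^sub>2 g, \<partial>\<^sub>2h + \<zeta>\<^sub>1 g)\<close>; it is bijective by Euler's identity.

  The multiplicities therefore satisfy a recursion in the number of doublets, which the difference of
  products of binomial coefficients also satisfies, by Pascal's rule (\<open>V_multiplicity_closed_form\<close>).
\<close>

section \<open>Binary forms and the Clebsch-Gordan rule\<close>

lemma V_carrier_scale: "f \<in> V_carrier r \<Longrightarrow> (\<lambda>\<zeta>. c * f \<zeta>) \<in> V_carrier r"
proof -
  assume "f \<in> V_carrier r"
  then obtain a where "f = (\<lambda>\<zeta>. \<Sum>i\<le>r. a i * (\<zeta> $ 1) ^ (r - i) * (\<zeta> $ 2) ^ i)"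
    by (auto simp: V_carrier_def)
  then have "(\<lambda>\<zeta>. c * f \<zeta>) = (\<lambda>\<zeta>. \<Sum>i\<le>r. (c * a i) * (\<zeta> $ 1) ^ (r - i) * (\<zeta> $ 2) ^ i)"
    by (simp add: sum_distrib_left mult_ac)
  then show ?thesis
    unfolding V_carrier_def by (intro CollectI exI)
qed

lemma V_carrier_add: "f \<in> V_carrier r \<Longrightarrow> g \<in> V_carrier r \<Longrightarrow> (\<lambda>\<zeta>. f \<zeta> + g \<zeta>) \<in> V_carrier r"
proof -
  assume "f \<in> V_carrier r" "g \<in> V_carrier r"
  then obtain a b where "f = (\<lambda>\<zeta>. \<Sum>i\<le>r. a i * (\<zeta> $ 1) ^ (r - i) * (\<zeta> $ 2) ^ i)"
    "g = (\<lambda>\<zeta>. \<Sum>i\<le>r. b i * (\<zeta> $ 1) ^ (r - i) * (\<zeta> $ 2) ^ i)"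
    by (auto simp: V_carrier_def)
  then have "(\<lambda>\<zeta>. f \<zeta> + g \<zeta>) = (\<lambda>\<zeta>. \<Sum>i\<le>r. (a i + b i) * (\<zeta> $ 1) ^ (r - i) * (\<zeta> $ 2) ^ i)"
    by (simp add: sum.distrib distrib_right)
  then show ?thesis
    unfolding V_carrier_def by (intro CollectI exI)
qed

lemma V_carrier_zero: "(\<lambda>\<zeta>. 0) \<in> V_carrier r"
  unfolding V_carrier_def by (intro CollectI exI[of _ "\<lambda>_. 0"]) simp

lemma V_carrier_diff:
  assumes "f \<in> V_carrier r" "g \<in> V_carrier r"
  shows "(\<lambda>\<zeta>. f \<zeta> - g \<zeta>) \<in> V_carrier r"
  using V_carrier_add[OF assms(1) V_carrier_scale[OF assms(2), of "-1"]] by simp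

lemma V_carrier_sum:
  assumes "finite I" "\<And>i. i \<in> I \<Longrightarrow> f i \<in> V_carrier r"
  shows "(\<lambda>\<zeta>. \<Sum>i\<in>I. f i \<zeta>) \<in> V_carrier r"
  using assms by (induction I) (auto intro: V_carrier_zero V_carrier_add)

lemma V_carrier_monomial:
  assumes "i + j = r"
  shows "(\<lambda>\<zeta>. (\<zeta> $ 1) ^ i * (\<zeta> $ 2) ^ j) \<in> V_carrier r"
proof -
  have "(\<Sum>l\<le>r. (if l = j then 1 else 0) * (\<zeta> $ 1) ^ (r - l) * (\<zeta> $ 2) ^ l) =
      (\<Sum>l\<le>r. if l = j then (\<zeta> $ 1) ^ i * (\<zeta> $ 2) ^ j else 0)" for \<zeta> :: "complex ^ 2"
    using assms by (intro sum.cong) auto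
  then have "(\<lambda>\<zeta>. (\<zeta> $ 1) ^ i * (\<zeta> $ 2) ^ j) = (\<lambda>\<zeta> :: complex ^ 2.
      \<Sum>l\<le>r. (if l = j then 1 else 0) * (\<zeta> $ 1) ^ (r - l) * (\<zeta> $ 2) ^ l)"
    using assms by simp
  then show ?thesis
    unfolding V_carrier_def by (intro CollectI exI)
qed

lemma V_carrier_mult_1:
  assumes "f \<in> V_carrier r"
  shows "(\<lambda>\<zeta>. \<zeta> $ 1 * f \<zeta>) \<in> V_carrier (Suc r)"
proof -
  obtain a where f: "f = (\<lambda>\<zeta>. \<Sum>i\<le>r. a i * (\<zeta> $ 1) ^ (r - i) * (\<zeta> $ 2) ^ i)"
    using assms by (auto simp: V_carrier_def)
  have "(\<lambda>\<zeta>. \<Sum>i\<le>r. a i * ((\<zeta> $ 1) ^ (Suc (r - i)) * (\<zeta> $ 2) ^ i)) \<in> V_carrier (Suc r)"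
    by (intro V_carrier_sum V_carrier_scale V_carrier_monomial) auto
  then show ?thesis
    by (simp add: f sum_distrib_left mult_ac)
qed

lemma V_carrier_mult_2:
  assumes "f \<in> V_carrier r"
  shows "(\<lambda>\<zeta>. \<zeta> $ 2 * f \<zeta>) \<in> V_carrier (Suc r)"
proof -
  obtain a where f: "f = (\<lambda>\<zeta>. \<Sum>i\<le>r. a i * (\<zeta> $ 1) ^ (r - i) * (\<zeta> $ 2) ^ i)"
    using assms by (auto simp: V_carrier_def)
  have "(\<lambda>\<zeta>. \<Sum>i\<le>r. a i * ((\<zeta> $ 1) ^ (r - i) * (\<zeta> $ 2) ^ (Suc i))) \<in> V_carrier (Suc r)"
    by (intro V_carrier_sum V_carrier_scale V_carrier_monomial) auto
  then show ?thesis
    by (simp add: f sum_distrib_left mult_ac)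
qed

lemma V_carrier_linear_power:
  assumes "f \<in> V_carrier r"
  shows "(\<lambda>\<zeta>. (x * \<zeta> $ 1 + y * \<zeta> $ 2) ^ i * f \<zeta>) \<in> V_carrier (i + r)"
proof (induction i)
  case 0
  then show ?case using assms by simp
next
  case (Suc i)
  have "(\<lambda>\<zeta>. x * (\<zeta> $ 1 * ((x * \<zeta> $ 1 + y * \<zeta> $ 2) ^ i * f \<zeta>)) +
      y * (\<zeta> $ 2 * ((x * \<zeta> $ 1 + y * \<zeta> $ 2) ^ i * f \<zeta>))) \<in> V_carrier (Suc (i + r))"
    by (intro V_carrier_add V_carrier_scale V_carrier_mult_1 V_carrier_mult_2 Suc)
  then show ?case
    by (simp add: algebra_simps)
qed

lemma vec_mult_su2:
  "(\<zeta> v* su2 q) $ 1 = fst q * \<zeta> $ 1 - cnj (snd q) * \<zeta> $ 2"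
  "(\<zeta> v* su2 q) $ 2 = snd q * \<zeta> $ 1 + cnj (fst q) * \<zeta> $ 2"
  by (simp_all add: vector_matrix_mult_def su2_def sum_2)

text \<open>
  A linear substitution in a monomial gives a product of powers of linear forms, and multiplication by
  a linear form raises the degree by one.
\<close>

lemma V_action_closed:
  assumes "f \<in> V_carrier r"
  shows "V_action q f \<in> V_carrier r"
proof -
  obtain a where f: "f = (\<lambda>\<zeta>. \<Sum>i\<le>r. a i * (\<zeta> $ 1) ^ (r - i) * (\<zeta> $ 2) ^ i)"
    using assms by (auto simp: V_carrier_def)
  have "(\<lambda>\<zeta>. \<Sum>i\<le>r. a i * ((fst q * \<zeta> $ 1 + (- cnj (snd q)) * \<zeta> $ 2) ^ (r - i) *
      ((snd q * \<zeta> $ 1 + cnj (fst q) * \<zeta> $ 2) ^ i * 1))) \<in> V_carrier r"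
  proof (intro V_carrier_sum V_carrier_scale)
    fix i assume "i \<in> {..r}"
    then have r: "r = (r - i) + (i + 0)"
      by simp
    then show "(\<lambda>\<zeta>. (fst q * \<zeta> $ 1 + (- cnj (snd q)) * \<zeta> $ 2) ^ (r - i) *
      ((snd q * \<zeta> $ 1 + cnj (fst q) * \<zeta> $ 2) ^ i * 1)) \<in> V_carrier r"
      using V_carrier_monomial[of 0 0 0] by (subst (2) r, intro V_carrier_linear_power) simp
  qed simp
  then show ?thesis
    by (simp add: f V_action_def vec_mult_su2 mult_ac)
qed

text \<open>
  Elements of \<open>V_carrier r\<close> are functions, but dehomogenising at \<open>\<zeta>\<^sub>1 = 1\<close> recovers the coefficients; so
  one may cancel \<open>\<zeta>\<^sub>1\<close> from identities between them.
\<close>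

lemma V_carrier_eq_zero:
  assumes "f \<in> V_carrier r" "\<And>\<zeta>. \<zeta> $ 1 \<noteq> 0 \<Longrightarrow> f \<zeta> = 0"
  shows "f \<zeta> = 0"
proof -
  obtain a where f: "f = (\<lambda>\<zeta>. \<Sum>i\<le>r. a i * (\<zeta> $ 1) ^ (r - i) * (\<zeta> $ 2) ^ i)"
    using assms by (auto simp: V_carrier_def)
  have "(\<Sum>i\<le>r. a i * t ^ i) = 0" for t
    using assms(2)[of "vector [1, t]"] by (simp add: f)
  then have "\<forall>i\<le>r. a i = 0"
    using polyfun_eq_0[of a r] by blast
  then show ?thesis
    by (simp add: f)
qed

text \<open>
  Defining the partial derivatives as derivatives along lines makes the chain rule for the linear
  substitutions \<open>\<zeta> \<mapsto> \<zeta> g\<close> immediate: such a substitution maps lines to lines (\<open>partial_deriv_action\<close>).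
\<close>

definition partial_deriv :: "2 \<Rightarrow> (complex ^ 2 \<Rightarrow> complex) \<Rightarrow> complex ^ 2 \<Rightarrow> complex" where
  "partial_deriv j h \<zeta> = deriv (\<lambda>t. h (\<zeta> + t *s axis j 1)) 0"

text \<open>
  All that the Clebsch-Gordan rule uses about derivatives: linearity in the direction, the degree of the partial
  derivatives, and Euler's identity.
\<close>

lemma V_carrier_derivative:
  assumes "h \<in> V_carrier (Suc r)"
  shows "\<And>\<zeta> \<eta>. ((\<lambda>t. h (\<zeta> + t *s \<eta>)) has_field_derivative
          \<eta> $ 1 * partial_deriv 1 h \<zeta> + \<eta> $ 2 * partial_deriv 2 h \<zeta>) (at 0)"
    and "partial_deriv 1 h \<in> V_carrier r" "partial_deriv 2 h \<in> V_carrier r"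
    and "\<zeta> $ 1 * partial_deriv 1 h \<zeta> + \<zeta> $ 2 * partial_deriv 2 h \<zeta> = of_nat (Suc r) * h \<zeta>"
proof -
  obtain a where h: "h = (\<lambda>\<zeta>. \<Sum>i\<le>Suc r. a i * (\<zeta> $ 1) ^ (Suc r - i) * (\<zeta> $ 2) ^ i)"
    using assms by (auto simp: V_carrier_def)
  define p1 where "p1 \<zeta> = (\<Sum>i\<le>Suc r. a i * (of_nat (Suc r - i) *
      ((\<zeta> $ 1) ^ (r - i) * (\<zeta> $ 2) ^ i)))" for \<zeta> :: "complex ^ 2"
  define p2 where "p2 \<zeta> = (\<Sum>i\<le>Suc r. a i * (of_nat i *
      ((\<zeta> $ 1) ^ (Suc r - i) * (\<zeta> $ 2) ^ (i - 1))))" for \<zeta> :: "complex ^ 2"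
  have D: "((\<lambda>t. h (\<zeta> + t *s \<eta>)) has_field_derivative \<eta> $ 1 * p1 \<zeta> + \<eta> $ 2 * p2 \<zeta>) (at 0)"
    for \<zeta> \<eta> :: "complex ^ 2"
    unfolding h p1_def p2_def sum_distrib_left sum.distrib[symmetric]
  proof (intro DERIV_sum)
    fix i
    show "((\<lambda>t. a i * ((\<zeta> + t *s \<eta>) $ 1) ^ (Suc r - i) * ((\<zeta> + t *s \<eta>) $ 2) ^ i) has_field_derivative
        \<eta> $ 1 * (a i * (of_nat (Suc r - i) * ((\<zeta> $ 1) ^ (r - i) * (\<zeta> $ 2) ^ i))) +
        \<eta> $ 2 * (a i * (of_nat i * ((\<zeta> $ 1) ^ (Suc r - i) * (\<zeta> $ 2) ^ (i - 1))))) (at 0)"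
      by (rule derivative_eq_intros refl | simp)+
  qed
  have p: "partial_deriv 1 h = p1" "partial_deriv 2 h = p2"
    using DERIV_imp_deriv[OF D[of _ "axis 1 1"]] DERIV_imp_deriv[OF D[of _ "axis 2 1"]]
    by (simp_all add: fun_eq_iff partial_deriv_def) (simp_all add: axis_def)
  show "((\<lambda>t. h (\<zeta> + t *s \<eta>)) has_field_derivative
      \<eta> $ 1 * partial_deriv 1 h \<zeta> + \<eta> $ 2 * partial_deriv 2 h \<zeta>) (at 0)" for \<zeta> \<eta>
    using D p by simp
  have q1: "(\<lambda>\<zeta>. of_nat (Suc r - i) * ((\<zeta> $ 1) ^ (r - i) * (\<zeta> $ 2) ^ i)) \<in> V_carrier r"
    if "i \<le> Suc r" for i
    using that by (cases "i = Suc r") (auto intro!: V_carrier_zero V_carrier_scale V_carrier_monomial)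
  have "p1 \<in> V_carrier r"
    unfolding p1_def by (rule V_carrier_sum, simp, rule V_carrier_scale, rule q1, simp)
  with p show "partial_deriv 1 h \<in> V_carrier r" by simp
  have q2: "(\<lambda>\<zeta>. of_nat i * ((\<zeta> $ 1) ^ (Suc r - i) * (\<zeta> $ 2) ^ (i - 1))) \<in> V_carrier r"
    if "i \<le> Suc r" for i
    using that by (cases "i = 0") (auto intro!: V_carrier_zero V_carrier_scale V_carrier_monomial)
  have "p2 \<in> V_carrier r"
    unfolding p2_def by (rule V_carrier_sum, simp, rule V_carrier_scale, rule q2, simp)
  with p show "partial_deriv 2 h \<in> V_carrier r" by simp
  have "\<zeta> $ 1 * (a i * (of_nat (Suc r - i) * ((\<zeta> $ 1) ^ (r - i) * (\<zeta> $ 2) ^ i)))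
      + \<zeta> $ 2 * (a i * (of_nat i * ((\<zeta> $ 1) ^ (Suc r - i) * (\<zeta> $ 2) ^ (i - 1)))) =
      of_nat (Suc r) * (a i * (\<zeta> $ 1) ^ (Suc r - i) * (\<zeta> $ 2) ^ i)" if "i \<le> Suc r" for i
  proof -
    have i: "\<zeta> $ 2 * (of_nat i * (\<zeta> $ 2) ^ (i - 1)) = of_nat i * (\<zeta> $ 2) ^ i"
      by (cases i) simp_all
    have d: "\<zeta> $ 1 * (of_nat (Suc r - i) * (\<zeta> $ 1) ^ (r - i)) = of_nat (Suc r - i) * (\<zeta> $ 1) ^ (Suc r - i)"
      using that by (cases "i = Suc r") (simp_all add: Suc_diff_le)
    have "\<zeta> $ 1 * (a i * (of_nat (Suc r - i) * ((\<zeta> $ 1) ^ (r - i) * (\<zeta> $ 2) ^ i)))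
        + \<zeta> $ 2 * (a i * (of_nat i * ((\<zeta> $ 1) ^ (Suc r - i) * (\<zeta> $ 2) ^ (i - 1)))) =
        a i * (\<zeta> $ 1 * (of_nat (Suc r - i) * (\<zeta> $ 1) ^ (r - i))) * (\<zeta> $ 2) ^ i
        + a i * (\<zeta> $ 1) ^ (Suc r - i) * (\<zeta> $ 2 * (of_nat i * (\<zeta> $ 2) ^ (i - 1)))"
      by (simp only: mult_ac)
    also have "\<dots> = (of_nat (Suc r - i) + of_nat i) * (a i * (\<zeta> $ 1) ^ (Suc r - i) * (\<zeta> $ 2) ^ i)"
      unfolding i d by (simp only: algebra_simps)
    also have "of_nat (Suc r - i) + of_nat i = (of_nat (Suc r) :: complex)"
      using that by (simp only: of_nat_add[symmetric] le_add_diff_inverse2)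
    finally show ?thesis .
  qed
  then have "\<zeta> $ 1 * p1 \<zeta> + \<zeta> $ 2 * p2 \<zeta> = of_nat (Suc r) * h \<zeta>"
    unfolding p1_def p2_def h sum_distrib_left sum.distrib[symmetric]
    by (intro sum.cong refl) (simp only: atMost_iff)
  then show "\<zeta> $ 1 * partial_deriv 1 h \<zeta> + \<zeta> $ 2 * partial_deriv 2 h \<zeta> = of_nat (Suc r) * h \<zeta>"
    by (simp only: p)
qed

lemma partial_deriv_add:
  assumes "h \<in> V_carrier (Suc r)" "h' \<in> V_carrier (Suc r)"
  shows "partial_deriv j (\<lambda>\<zeta>. h \<zeta> + h' \<zeta>) \<zeta> = partial_deriv j h \<zeta> + partial_deriv j h' \<zeta>"
  unfolding partial_deriv_def
  using V_carrier_derivative(1)[OF assms(1)] V_carrier_derivative(1)[OF assms(2)]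
  by (intro deriv_add) (meson field_differentiable_def)+

lemma partial_deriv_scale:
  assumes "h \<in> V_carrier (Suc r)"
  shows "partial_deriv j (\<lambda>\<zeta>. c * h \<zeta>) \<zeta> = c * partial_deriv j h \<zeta>"
  unfolding partial_deriv_def
  using V_carrier_derivative(1)[OF assms(1)]
  by (intro deriv_cmult) (meson field_differentiable_def)

lemma partial_deriv_zero: "partial_deriv j (\<lambda>\<zeta>. 0) \<zeta> = 0"
  by (simp add: partial_deriv_def)

lemma partial_deriv_action:
  assumes "h \<in> V_carrier (Suc r)"
  shows "partial_deriv 1 (\<lambda>\<zeta>. h (\<zeta> v* su2 q)) \<zeta> =
      fst q * partial_deriv 1 h (\<zeta> v* su2 q) + snd q * partial_deriv 2 h (\<zeta> v* su2 q)"
    and "partial_deriv 2 (\<lambda>\<zeta>. h (\<zeta> v* su2 q)) \<zeta> =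
      - cnj (snd q) * partial_deriv 1 h (\<zeta> v* su2 q) + cnj (fst q) * partial_deriv 2 h (\<zeta> v* su2 q)"
proof -
  have "partial_deriv j (\<lambda>\<zeta>. h (\<zeta> v* su2 q)) \<zeta> =
      (axis j 1 v* su2 q) $ 1 * partial_deriv 1 h (\<zeta> v* su2 q) + (axis j 1 v* su2 q) $ 2 * partial_deriv 2 h (\<zeta> v* su2 q)"
    for j
  proof -
    have *: "(\<zeta> + t *s axis j 1) v* su2 q = \<zeta> v* su2 q + t *s (axis j 1 v* su2 q)" for t
      by (simp add: vec_eq_iff forall_2 vec_mult_su2 algebra_simps)
    show ?thesis
      unfolding partial_deriv_def[of j] * by (intro DERIV_imp_deriv V_carrier_derivative(1)[OF assms])
  qed
  then show "partial_deriv 1 (\<lambda>\<zeta>. h (\<zeta> v* su2 q)) \<zeta> =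
      fst q * partial_deriv 1 h (\<zeta> v* su2 q) + snd q * partial_deriv 2 h (\<zeta> v* su2 q)"
    and "partial_deriv 2 (\<lambda>\<zeta>. h (\<zeta> v* su2 q)) \<zeta> =
      - cnj (snd q) * partial_deriv 1 h (\<zeta> v* su2 q) + cnj (fst q) * partial_deriv 2 h (\<zeta> v* su2 q)"
    by (simp_all add: vec_mult_su2 axis_def)
qed

text \<open>
  Euler's identity recovers \<open>h\<close> from \<open>(\<partial>\<^sub>1h - \<zeta>\<^sub>2 g, \<partial>\<^sub>2h + \<zeta>\<^sub>1 g)\<close>, since the terms with \<open>g\<close> cancel
  when the components are multiplied by \<open>\<zeta>\<^sub>1\<close> and \<open>\<zeta>\<^sub>2\<close> and added.
\<close>

lemma clebsch_gordan_inj: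
  assumes h: "h \<in> V_carrier (Suc r)" and g: "g \<in> V_carrier s"
    and "\<And>\<zeta>. partial_deriv 1 h \<zeta> = \<zeta> $ 2 * g \<zeta>" "\<And>\<zeta>. partial_deriv 2 h \<zeta> = - (\<zeta> $ 1 * g \<zeta>)"
  shows "h \<zeta> = 0" "g \<zeta> = 0"
proof -
  have h0: "h \<zeta> = 0" for \<zeta>
    using V_carrier_derivative(4)[OF h, of \<zeta>] assms(3,4) by (simp del: of_nat_Suc)
  then show "h \<zeta> = 0" .
  have "h = (\<lambda>\<zeta>. 0)" using h0 by auto
  then have "\<zeta> $ 1 * g \<zeta> = 0" for \<zeta>
    using assms(4)[of \<zeta>] partial_deriv_zero by simp
  then show "g \<zeta> = 0"
    using V_carrier_eq_zero[OF g] by (metis mult_eq_0_iff)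
qed

text \<open>
  The kernel of \<open>(p1, p2) \<mapsto> \<zeta>\<^sub>1 p1 + \<zeta>\<^sub>2 p2\<close> is generated by \<open>(- \<zeta>\<^sub>2, \<zeta>\<^sub>1)\<close>, as \<open>\<zeta>\<^sub>1\<close> and \<open>\<zeta>\<^sub>2\<close> are
  coprime. For \<open>r = 0\<close> the factor \<open>g\<close> would have degree \<open>-1\<close>, hence is zero.
\<close>

lemma V_carrier_syzygy:
  assumes p1: "p1 \<in> V_carrier r" and p2: "p2 \<in> V_carrier r"
    and zero: "\<And>\<zeta>. \<zeta> $ 1 * p1 \<zeta> + \<zeta> $ 2 * p2 \<zeta> = 0"
  obtains g where "if r = 0 then g = (\<lambda>\<zeta>. 0) else g \<in> V_carrier (r - 1)"
    "\<And>\<zeta>. p1 \<zeta> = - (\<zeta> $ 2 * g \<zeta>)" "\<And>\<zeta>. p2 \<zeta> = \<zeta> $ 1 * g \<zeta>"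
proof -
  obtain b where b: "p2 = (\<lambda>\<zeta>. \<Sum>i\<le>r. b i * (\<zeta> $ 1) ^ (r - i) * (\<zeta> $ 2) ^ i)"
    using p2 by (auto simp: V_carrier_def)
  \<comment> \<open>At \<open>\<zeta> = (0, 1)\<close> only the coefficient of \<open>\<zeta>\<^sub>2\<^sup>r\<close> survives, so \<open>\<zeta>\<^sub>1\<close> divides \<open>p2\<close>.\<close>
  have "(\<Sum>i\<le>r. b i * 0 ^ (r - i)) = 0"
    using zero[of "vector [0, 1]"] by (simp add: b)
  also have "(\<Sum>i\<le>r. b i * 0 ^ (r - i)) = (\<Sum>i\<le>r. if i = r then b i else 0)"
    by (intro sum.cong) auto
  finally have br: "b r = 0" by simp
  define g where "g \<zeta> = (\<Sum>i<r. b i * ((\<zeta> $ 1) ^ (r - 1 - i) * (\<zeta> $ 2) ^ i))" for \<zeta> :: "complex ^ 2"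
  have g: "if r = 0 then g = (\<lambda>\<zeta>. 0) else g \<in> V_carrier (r - 1)"
    unfolding g_def by (auto intro!: V_carrier_sum V_carrier_scale V_carrier_monomial)
  have p2g: "p2 \<zeta> = \<zeta> $ 1 * g \<zeta>" for \<zeta>
  proof -
    have "p2 \<zeta> = (\<Sum>i<r. b i * (\<zeta> $ 1) ^ (r - i) * (\<zeta> $ 2) ^ i)"
      using br by (simp add: b flip: lessThan_Suc_atMost)
    also have "\<dots> = \<zeta> $ 1 * g \<zeta>"
      unfolding g_def sum_distrib_left
    proof (intro sum.cong refl)
      fix i assume "i \<in> {..<r}"
      then have "r - i = Suc (r - 1 - i)" by auto
      then show "b i * (\<zeta> $ 1) ^ (r - i) * (\<zeta> $ 2) ^ i =
          \<zeta> $ 1 * (b i * ((\<zeta> $ 1) ^ (r - 1 - i) * (\<zeta> $ 2) ^ i))"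
        by (simp del: diff_Suc_1)
    qed
    finally show ?thesis .
  qed
  have "(\<lambda>\<zeta>. p1 \<zeta> + \<zeta> $ 2 * g \<zeta>) \<in> V_carrier r"
  proof (intro V_carrier_add p1)
    show "(\<lambda>\<zeta>. \<zeta> $ 2 * g \<zeta>) \<in> V_carrier r"
      using g V_carrier_mult_2[of g "r - 1"] V_carrier_zero[of r] by (cases r) simp_all
  qed
  moreover have "p1 \<zeta> + \<zeta> $ 2 * g \<zeta> = 0" if "\<zeta> $ 1 \<noteq> 0" for \<zeta>
  proof -
    have "\<zeta> $ 1 * (p1 \<zeta> + \<zeta> $ 2 * g \<zeta>) = 0"
      using zero[of \<zeta>] by (simp add: p2g algebra_simps)
    then show ?thesis using that by simp
  qed
  ultimately have "p1 \<zeta> + \<zeta> $ 2 * g \<zeta> = 0" for \<zeta>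
    using V_carrier_eq_zero by blast
  then have "p1 \<zeta> = - (\<zeta> $ 2 * g \<zeta>)" for \<zeta>
    by (simp add: eq_neg_iff_add_eq_0)
  with g p2g that show ?thesis by blast
qed

text \<open>
  The component \<open>h\<close> is forced by Euler's identity; what remains is a syzygy.
\<close>

lemma clebsch_gordan_surj:
  assumes f1: "f1 \<in> V_carrier r" and f2: "f2 \<in> V_carrier r"
  obtains h g where "h \<in> V_carrier (Suc r)" "if r = 0 then g = (\<lambda>\<zeta>. 0) else g \<in> V_carrier (r - 1)"
    "\<And>\<zeta>. f1 \<zeta> = partial_deriv 1 h \<zeta> - \<zeta> $ 2 * g \<zeta>" "\<And>\<zeta>. f2 \<zeta> = partial_deriv 2 h \<zeta> + \<zeta> $ 1 * g \<zeta>"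
proof -
  define h where "h \<zeta> = inverse (of_nat (Suc r)) * (\<zeta> $ 1 * f1 \<zeta> + \<zeta> $ 2 * f2 \<zeta>)" for \<zeta>
  have h: "h \<in> V_carrier (Suc r)"
    unfolding h_def by (intro V_carrier_scale V_carrier_add V_carrier_mult_1 V_carrier_mult_2 f1 f2)
  note D = V_carrier_derivative[OF h]
  have "\<zeta> $ 1 * (f1 \<zeta> - partial_deriv 1 h \<zeta>) + \<zeta> $ 2 * (f2 \<zeta> - partial_deriv 2 h \<zeta>) = 0" for \<zeta>
  proof -
    have "of_nat (Suc r) * h \<zeta> = \<zeta> $ 1 * f1 \<zeta> + \<zeta> $ 2 * f2 \<zeta>"
      by (simp add: h_def del: of_nat_Suc)
    then show ?thesis
      using D(4)[of \<zeta>] by (simp add: algebra_simps)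
  qed
  then obtain g where "if r = 0 then g = (\<lambda>\<zeta>. 0) else g \<in> V_carrier (r - 1)"
    "\<And>\<zeta>. f1 \<zeta> - partial_deriv 1 h \<zeta> = - (\<zeta> $ 2 * g \<zeta>)" "\<And>\<zeta>. f2 \<zeta> - partial_deriv 2 h \<zeta> = \<zeta> $ 1 * g \<zeta>"
    using V_carrier_syzygy[OF V_carrier_diff[OF f1 D(2)] V_carrier_diff[OF f2 D(3)]] by blast
  then show ?thesis
    using h that[of h g] by (simp add: algebra_simps)
qed

section \<open>Multiplicities and direct sums\<close>

lemma fscale_apply [simp]: "fscale a f x = a * f x"
  by (simp add: fscale_def)

lemma V_sum_component:
  "c \<in> V_sum_carrier R m \<Longrightarrow> r \<in> R \<Longrightarrow> j < m r \<Longrightarrow> (\<lambda>\<zeta>. c (r, j, \<zeta>)) \<in> V_carrier r"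
  unfolding V_sum_carrier_def by (metis (mono_tags, lifting) mem_Collect_eq)

lemma V_sum_component_zero:
  "c \<in> V_sum_carrier R m \<Longrightarrow> \<not> (r \<in> R \<and> j < m r) \<Longrightarrow> c (r, j, \<zeta>) = 0"
  unfolding V_sum_carrier_def by (metis (mono_tags, lifting) mem_Collect_eq)

lemma V_sum_carrierI:
  assumes "\<And>r j. r \<in> R \<Longrightarrow> j < m r \<Longrightarrow> (\<lambda>\<zeta>. c (r, j, \<zeta>)) \<in> V_carrier r"
    and "\<And>r j \<zeta>. \<not> (r \<in> R \<and> j < m r) \<Longrightarrow> c (r, j, \<zeta>) = 0"
  shows "c \<in> V_sum_carrier R m"
  using assms by (simp add: V_sum_carrier_def)

lemma V_sum_zero: "0 \<in> V_sum_carrier R m"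
  by (intro V_sum_carrierI) (auto intro: V_carrier_zero)

lemma V_sum_add: "c \<in> V_sum_carrier R m \<Longrightarrow> d \<in> V_sum_carrier R m \<Longrightarrow> c + d \<in> V_sum_carrier R m"
  by (intro V_sum_carrierI) (auto intro: V_carrier_add V_sum_component simp: V_sum_component_zero)

lemma V_sum_scale: "c \<in> V_sum_carrier R m \<Longrightarrow> fscale a c \<in> V_sum_carrier R m"
  by (intro V_sum_carrierI) (auto intro: V_carrier_scale V_sum_component simp: V_sum_component_zero)

lemma V_sum_action_apply: "V_sum_action q c (r, j, \<zeta>) = c (r, j, \<zeta> v* su2 q)"
  by (simp add: V_sum_action_def V_action_def)

lemma V_sum_action_closed: "c \<in> V_sum_carrier R m \<Longrightarrow> V_sum_action q c \<in> V_sum_carrier R m"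
proof (intro V_sum_carrierI)
  fix r j assume "c \<in> V_sum_carrier R m" "r \<in> R" "j < m r"
  from V_action_closed[OF V_sum_component[OF this]]
  show "(\<lambda>\<zeta>. V_sum_action q c (r, j, \<zeta>)) \<in> V_carrier r"
    by (simp add: V_sum_action_apply V_action_def)
qed (auto simp: V_sum_action_apply V_sum_component_zero)

lemma module_fscale: "module fscale"
  by standard (auto simp: fun_eq_iff algebra_simps)

lemma subspace_fscale:
  "module.subspace fscale V \<longleftrightarrow>
    0 \<in> V \<and> (\<forall>f\<in>V. \<forall>g\<in>V. f + g \<in> V) \<and> (\<forall>a. \<forall>f\<in>V. fscale a f \<in> V)"
  by (simp add: module.subspace_def[OF module_fscale])

lemma su2_one: "\<zeta> v* su2 q_one = \<zeta>"
  by (simp add: vec_eq_iff forall_2 vec_mult_su2 q_one_def)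

lemma Sp1_rep_V_sum: "Sp1_rep (V_sum_carrier R m) V_sum_action"
  by (auto simp: Sp1_rep_def subspace_fscale V_sum_zero V_sum_add V_sum_scale V_sum_action_closed
      fun_eq_iff V_sum_action_apply su2_qmult su2_one vector_matrix_mul_assoc)

text \<open>
  \<open>G\<close> is an isomorphism of representations from the direct sum of \<open>m r\<close> copies of each \<open>V\<^sub>r\<close> onto \<open>V\<close>.
  The direction out of the direct sum is the one in which summands can be assembled. All \<open>r\<close> are allowed here, so
  that multiplicity functions can be added without keeping track of their supports.
\<close>

definition intertwines ::
  "(quat \<Rightarrow> ('x \<Rightarrow> complex) \<Rightarrow> 'x \<Rightarrow> complex) \<Rightarrow> (nat \<Rightarrow> nat) \<Rightarrow>
    ((nat \<times> nat \<times> (complex ^ 2) \<Rightarrow> complex) \<Rightarrow> 'x \<Rightarrow> complex) \<Rightarrow> ('x \<Rightarrow> complex) set \<Rightarrow> bool" where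
  "intertwines \<rho> m G V \<longleftrightarrow> G ` V_sum_carrier UNIV m = V \<and>
     (\<forall>c\<in>V_sum_carrier UNIV m. \<forall>d\<in>V_sum_carrier UNIV m. G (c + d) = G c + G d) \<and>
     (\<forall>a. \<forall>c\<in>V_sum_carrier UNIV m. G (fscale a c) = fscale a (G c)) \<and>
     (\<forall>q\<in>Sp1. \<forall>c\<in>V_sum_carrier UNIV m. G (V_sum_action q c) = \<rho> q (G c)) \<and>
     (\<forall>c\<in>V_sum_carrier UNIV m. G c = 0 \<longrightarrow> c = 0)"

definition decomposes ::
  "(quat \<Rightarrow> ('x \<Rightarrow> complex) \<Rightarrow> 'x \<Rightarrow> complex) \<Rightarrow> (nat \<Rightarrow> nat) \<Rightarrow> ('x \<Rightarrow> complex) set \<Rightarrow> bool" where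
  "decomposes \<rho> m V \<longleftrightarrow> (\<exists>G. intertwines \<rho> m G V)"

lemma intertwinesD:
  assumes "intertwines \<rho> m G V"
  shows "G ` V_sum_carrier UNIV m = V"
    "\<And>c d. c \<in> V_sum_carrier UNIV m \<Longrightarrow> d \<in> V_sum_carrier UNIV m \<Longrightarrow> G (c + d) = G c + G d"
    "\<And>a c. c \<in> V_sum_carrier UNIV m \<Longrightarrow> G (fscale a c) = fscale a (G c)"
    "\<And>q c. q \<in> Sp1 \<Longrightarrow> c \<in> V_sum_carrier UNIV m \<Longrightarrow> G (V_sum_action q c) = \<rho> q (G c)"
    "\<And>c. c \<in> V_sum_carrier UNIV m \<Longrightarrow> G c = 0 \<Longrightarrow> c = 0"
  using assms by (simp_all add: intertwines_def)

lemma decomposesI: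
  assumes "\<And>c. c \<in> V_sum_carrier UNIV m \<Longrightarrow> G c \<in> V"
    "\<And>f. f \<in> V \<Longrightarrow> \<exists>c\<in>V_sum_carrier UNIV m. f = G c"
    "\<And>c d. c \<in> V_sum_carrier UNIV m \<Longrightarrow> d \<in> V_sum_carrier UNIV m \<Longrightarrow> G (c + d) = G c + G d"
    "\<And>a c. c \<in> V_sum_carrier UNIV m \<Longrightarrow> G (fscale a c) = fscale a (G c)"
    "\<And>q c. q \<in> Sp1 \<Longrightarrow> c \<in> V_sum_carrier UNIV m \<Longrightarrow> G (V_sum_action q c) = \<rho> q (G c)"
    "\<And>c. c \<in> V_sum_carrier UNIV m \<Longrightarrow> G c = 0 \<Longrightarrow> c = 0"
  shows "decomposes \<rho> m V"
  unfolding decomposes_def intertwines_def using assms(1,2)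
  by (intro exI[of _ G] conjI ballI allI impI subset_antisym image_subsetI subsetI assms) auto

lemma decomposes_subspace:
  assumes "decomposes \<rho> m V"
  shows "0 \<in> V" "f \<in> V \<Longrightarrow> g \<in> V \<Longrightarrow> f + g \<in> V" "f \<in> V \<Longrightarrow> fscale a f \<in> V"
    "f \<in> V \<Longrightarrow> q \<in> Sp1 \<Longrightarrow> \<rho> q f \<in> V"
proof -
  obtain G where "intertwines \<rho> m G V"
    using assms unfolding decomposes_def by blast
  note G = intertwinesD[OF this]
  have "G 0 = G (fscale 0 0)" by (rule arg_cong[of _ _ G]) (simp add: fun_eq_iff)
  also have "\<dots> = 0" using G(3)[OF V_sum_zero] by (simp add: fun_eq_iff)
  finally show "0 \<in> V" using G(1) V_sum_zero by (metis image_eqI)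
  show "f + g \<in> V" if fg: "f \<in> V" "g \<in> V"
  proof -
    obtain c d where "c \<in> V_sum_carrier UNIV m" "d \<in> V_sum_carrier UNIV m" "f = G c" "g = G d"
      using fg unfolding G(1)[symmetric] by blast
    then show ?thesis
      unfolding G(1)[symmetric] by (intro image_eqI[of _ _ "c + d"]) (simp_all add: G(2) V_sum_add)
  qed
  show "fscale a f \<in> V" if fg: "f \<in> V"
  proof -
    obtain c where "c \<in> V_sum_carrier UNIV m" "f = G c"
      using fg unfolding G(1)[symmetric] by blast
    then show ?thesis
      unfolding G(1)[symmetric] by (intro image_eqI[of _ _ "fscale a c"]) (simp_all add: G(3) V_sum_scale)
  qed
  show "\<rho> q f \<in> V" if fg: "f \<in> V" and q: "q \<in> Sp1"
  proof -
    obtain c where "c \<in> V_sum_carrier UNIV m" "f = G c"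
      using fg unfolding G(1)[symmetric] by blast
    then show ?thesis
      unfolding G(1)[symmetric] using q
      by (intro image_eqI[of _ _ "V_sum_action q c"]) (simp_all add: G(4) V_sum_action_closed)
  qed
qed

lemma decomposes_Sp1_isomorphic:
  assumes "decomposes \<rho> m V" "Sp1_rep V \<rho>"
  shows "Sp1_isomorphic V \<rho> (V_sum_carrier UNIV m) V_sum_action"
proof -
  let ?W = "V_sum_carrier UNIV m"
  obtain G where "intertwines \<rho> m G V"
    using assms(1) unfolding decomposes_def by blast
  note G = intertwinesD[OF this]
  have inj: "inj_on G ?W"
  proof (rule inj_onI)
    fix c d assume cd: "c \<in> ?W" "d \<in> ?W" "G c = G d"
    have "G (c + fscale (-1) d) = 0"
      using cd by (simp add: G(2,3) V_sum_scale fun_eq_iff)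
    then have "c + fscale (-1) d = 0"
      using G(5) cd V_sum_add V_sum_scale by blast
    then show "c = d" by (simp add: fun_eq_iff)
  qed
  define F where "F = inv_into ?W G"
  have F: "F f \<in> ?W" "G (F f) = f" if "f \<in> V" for f
    using inv_into_into[of f G ?W] f_inv_into_f[of f G ?W] that unfolding F_def G(1) by blast+
  have FG: "F f = c" if "c \<in> ?W" "f = G c" for c f
    using that inj unfolding F_def by simp
  have "bij_betw F V ?W"
    unfolding F_def using inj G(1) by (metis bij_betw_def bij_betw_inv_into)
  moreover have "F (f + g) = F f + F g" if "f \<in> V" "g \<in> V" for f g
    using that F by (intro FG) (simp_all add: G(2) V_sum_add)
  moreover have "F (fscale a f) = fscale a (F f)" if "f \<in> V" for f a
    using that F by (intro FG) (simp_all add: G(3) V_sum_scale)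
  moreover have "F (\<rho> q f) = V_sum_action q (F f)" if "f \<in> V" "q \<in> Sp1" for f q
    using that F by (intro FG) (simp_all add: G(4) V_sum_action_closed)
  ultimately show ?thesis
    unfolding Sp1_isomorphic_def using assms(2) Sp1_rep_V_sum by blast
qed

lemma decomposes_image:
  assumes V: "decomposes \<rho> m V"
    and add: "\<And>f g. f \<in> V \<Longrightarrow> g \<in> V \<Longrightarrow> B (f + g) = B f + B g"
    and scale: "\<And>a f. f \<in> V \<Longrightarrow> B (fscale a f) = fscale a (B f)"
    and equiv: "\<And>q f. q \<in> Sp1 \<Longrightarrow> f \<in> V \<Longrightarrow> B (\<rho> q f) = \<sigma> q (B f)"
    and inj: "\<And>f. f \<in> V \<Longrightarrow> B f = 0 \<Longrightarrow> f = 0"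
  shows "decomposes \<sigma> m (B ` V)"
proof -
  obtain G where "intertwines \<rho> m G V"
    using V unfolding decomposes_def by blast
  note G = intertwinesD[OF this]
  have GV: "G c \<in> V" if "c \<in> V_sum_carrier UNIV m" for c
    using that G(1) by blast
  show ?thesis
  proof (rule decomposesI[where G = "\<lambda>c. B (G c)"])
    show "\<exists>c\<in>V_sum_carrier UNIV m. f = B (G c)" if "f \<in> B ` V" for f
      using that unfolding G(1)[symmetric] by blast
    show "c = 0" if "c \<in> V_sum_carrier UNIV m" "B (G c) = 0" for c
      using that inj G(5) GV by blast
    show "B (G c) \<in> B ` V" if "c \<in> V_sum_carrier UNIV m" for c
      using GV[OF that] by (rule imageI)
    show "B (G (c + d)) = B (G c) + B (G d)" if "c \<in> V_sum_carrier UNIV m" "d \<in> V_sum_carrier UNIV m" for c d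
      using that by (simp only: G(2) GV add)
    show "B (G (fscale a c)) = fscale a (B (G c))" if "c \<in> V_sum_carrier UNIV m" for a c
      using that by (simp only: G(3) GV scale)
    show "B (G (V_sum_action q c)) = \<sigma> q (B (G c))" if "q \<in> Sp1" "c \<in> V_sum_carrier UNIV m" for q c
      using that by (simp only: G(4) GV equiv)
  qed
qed

text \<open>
  The copies of \<open>V\<^sub>r\<close> in the first summand are numbered from 0, those in the second one from \<open>m r\<close>.
\<close>

lemma decomposes_direct_sum:
  assumes V: "decomposes \<rho> m V" and V': "decomposes \<rho> m' V'"
    and disjoint: "V \<inter> V' \<subseteq> {0}"
    and add: "\<And>q f g. q \<in> Sp1 \<Longrightarrow> f \<in> V \<Longrightarrow> g \<in> V' \<Longrightarrow> \<rho> q (f + g) = \<rho> q f + \<rho> q g"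
  shows "decomposes \<rho> (\<lambda>r. m r + m' r) {f + g |f g. f \<in> V \<and> g \<in> V'}"
proof -
  let ?W = "V_sum_carrier UNIV m" and ?W' = "V_sum_carrier UNIV m'"
  let ?U = "V_sum_carrier UNIV (\<lambda>r. m r + m' r)"
  obtain G where "intertwines \<rho> m G V"
    using V unfolding decomposes_def by blast
  note G = intertwinesD[OF this]
  obtain G' where "intertwines \<rho> m' G' V'"
    using V' unfolding decomposes_def by blast
  note G' = intertwinesD[OF this]
  define L :: "(nat \<times> nat \<times> (complex ^ 2) \<Rightarrow> complex) \<Rightarrow> nat \<times> nat \<times> (complex ^ 2) \<Rightarrow> complex"
    where "L c = (\<lambda>(r, j, \<zeta>). if j < m r then c (r, j, \<zeta>) else 0)" for c
  define L' :: "(nat \<times> nat \<times> (complex ^ 2) \<Rightarrow> complex) \<Rightarrow> nat \<times> nat \<times> (complex ^ 2) \<Rightarrow> complex"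
    where "L' c = (\<lambda>(r, j, \<zeta>). if j < m' r then c (r, m r + j, \<zeta>) else 0)" for c
  have L: "L c \<in> ?W" "L' c \<in> ?W'" if "c \<in> ?U" for c
    by (auto intro!: V_sum_carrierI simp: L_def L'_def V_sum_component[OF that] split: if_splits)
  have L_lin: "L (c + d) = L c + L d" "L' (c + d) = L' c + L' d"
    "L (fscale a c) = fscale a (L c)" "L' (fscale a c) = fscale a (L' c)"
    "L (V_sum_action q c) = V_sum_action q (L c)" "L' (V_sum_action q c) = V_sum_action q (L' c)"
    for c d a q
    by (auto simp: L_def L'_def fun_eq_iff V_sum_action_apply)
  have GV: "G (L c) \<in> V" "G' (L' c) \<in> V'" if "c \<in> ?U" for c
    using L[OF that] G(1) G'(1) by blast+
  show ?thesis
  proof (rule decomposesI[where G = "\<lambda>c. G (L c) + G' (L' c)"])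
    show "G (L c) + G' (L' c) \<in> {f + g |f g. f \<in> V \<and> g \<in> V'}" if "c \<in> ?U" for c
      using GV[OF that] by blast
  next
    fix f assume "f \<in> {f + g |f g. f \<in> V \<and> g \<in> V'}"
    then obtain c d where cd: "c \<in> ?W" "d \<in> ?W'" "f = G c + G' d"
      using G(1) G'(1) by blast
    define e :: "nat \<times> nat \<times> (complex ^ 2) \<Rightarrow> complex"
      where "e = (\<lambda>(r, j, \<zeta>). if j < m r then c (r, j, \<zeta>) else d (r, j - m r, \<zeta>))"
    have "e \<in> ?U"
    proof (rule V_sum_carrierI)
      fix r j assume j: "j < m r + m' r"
      show "(\<lambda>\<zeta>. e (r, j, \<zeta>)) \<in> V_carrier r"
        using V_sum_component[OF cd(1), of r j] V_sum_component[OF cd(2), of r "j - m r"] j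
        by (cases "j < m r") (simp_all add: e_def)
    qed (auto simp: e_def V_sum_component_zero[OF cd(2)])
    moreover have "L e = c" "L' e = d"
      using V_sum_component_zero[OF cd(1)] V_sum_component_zero[OF cd(2)]
      by (auto simp: fun_eq_iff L_def L'_def e_def)
    ultimately show "\<exists>c\<in>?U. f = G (L c) + G' (L' c)"
      using cd(3) by metis
  next
    show "G (L (c + d)) + G' (L' (c + d)) = G (L c) + G' (L' c) + (G (L d) + G' (L' d))"
      if "c \<in> ?U" "d \<in> ?U" for c d
      using that by (simp add: L L_lin G(2) G'(2))
    show "G (L (fscale a c)) + G' (L' (fscale a c)) = fscale a (G (L c) + G' (L' c))"
      if "c \<in> ?U" for a c
      using that by (simp add: L L_lin G(3) G'(3) fun_eq_iff algebra_simps)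
    show "G (L (V_sum_action q c)) + G' (L' (V_sum_action q c)) = \<rho> q (G (L c) + G' (L' c))"
      if "q \<in> Sp1" "c \<in> ?U" for q c
      using that by (simp add: L L_lin G(4) G'(4) add GV)
  next
    fix c assume c: "c \<in> ?U" "G (L c) + G' (L' c) = 0"
    then have "G (L c) = fscale (-1) (G' (L' c))"
      by (simp add: fun_eq_iff eq_neg_iff_add_eq_0)
    then have "G (L c) \<in> V'"
      using decomposes_subspace(3)[OF V'] GV(2)[OF c(1)] by simp
    then have "G (L c) = 0" using disjoint GV(1)[OF c(1)] by blast
    then have *: "L c = 0" "L' c = 0"
      using c G(5) G'(5) L by (metis add_0)+
    show "c = 0"
    proof (rule ext, clarify)
      fix r j and \<zeta> :: "complex ^ 2"
      consider "j < m r" | j' where "j = m r + j'" "j' < m' r" | "\<not> j < m r + m' r"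
        by (metis add_less_cancel_left le_iff_add linorder_not_less)
      then show "c (r, j, \<zeta>) = 0 (r, j, \<zeta>)"
      proof cases
        case 1
        then show ?thesis using fun_cong[OF *(1), of "(r, j, \<zeta>)"] by (simp add: L_def)
      next
        case 2
        then show ?thesis using fun_cong[OF *(2), of "(r, j', \<zeta>)"] by (simp add: L'_def)
      next
        case 3
        then show ?thesis using V_sum_component_zero[OF c(1)] by simp
      qed
    qed
  qed
qed

text \<open>
  Clebsch-Gordan: \<open>V\<^sub>r\<close> occurs once in \<open>V\<^sub>r\<^sub>-\<^sub>1 \<otimes> V\<^sub>1\<close> (if \<open>r > 0\<close>) and once in \<open>V\<^sub>r\<^sub>+\<^sub>1 \<otimes> V\<^sub>1\<close>.
\<close>

definition tensor_V1_mult :: "(nat \<Rightarrow> nat) \<Rightarrow> nat \<Rightarrow> nat" where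
  "tensor_V1_mult m r = (case r of 0 \<Rightarrow> 0 | Suc s \<Rightarrow> m s) + m (Suc r)"

text \<open>
  The hypotheses say that \<open>B1 f + B2 g\<close> stands for \<open>x1 \<otimes> f + x2 \<otimes> g\<close> with \<open>x1, x2\<close> the
  standard basis of \<open>V\<^sub>1\<close>. Of the copies of \<open>V\<^sub>r\<close> in the result, the first ones are the parts
  \<open>h\<close> coming from the copies of \<open>V\<^sub>r\<^sub>-\<^sub>1\<close> in \<open>V\<close>, the remaining ones the parts \<open>g\<close> coming
  from the copies of \<open>V\<^sub>r\<^sub>+\<^sub>1\<close>.
\<close>

lemma decomposes_tensor_V1:
  assumes V: "decomposes \<rho> m V"
    and add: "\<And>f g. B1 (f + g) = B1 f + B1 g" "\<And>f g. B2 (f + g) = B2 f + B2 g"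
    and scale: "\<And>a f. B1 (fscale a f) = fscale a (B1 f)" "\<And>a f. B2 (fscale a f) = fscale a (B2 f)"
    and equiv: "\<And>q f g. q \<in> Sp1 \<Longrightarrow> f \<in> V \<Longrightarrow> g \<in> V \<Longrightarrow> \<rho> q (B1 f + B2 g) =
      B1 (fscale (fst q) (\<rho> q f) + fscale (snd q) (\<rho> q g)) +
      B2 (fscale (- cnj (snd q)) (\<rho> q f) + fscale (cnj (fst q)) (\<rho> q g))"
    and inj: "\<And>f g. f \<in> V \<Longrightarrow> g \<in> V \<Longrightarrow> B1 f + B2 g = 0 \<Longrightarrow> f = 0 \<and> g = 0"
  shows "decomposes \<rho> (tensor_V1_mult m) {B1 f + B2 g |f g. f \<in> V \<and> g \<in> V}"
proof -
  let ?W = "V_sum_carrier UNIV m" and ?U = "V_sum_carrier UNIV (tensor_V1_mult m)"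
  obtain G where "intertwines \<rho> m G V"
    using V unfolding decomposes_def by blast
  note G = intertwinesD[OF this]
  \<comment> \<open>The index at which the copies of the second kind start.\<close>
  define off where "off r = (case r of 0 \<Rightarrow> 0 | Suc s \<Rightarrow> m s)" for r
  have off: "tensor_V1_mult m r = off r + m (Suc r)" "off (Suc r) = m r" "off 0 = 0" for r
    by (simp_all add: tensor_V1_mult_def off_def)
  define low :: "(nat \<times> nat \<times> (complex ^ 2) \<Rightarrow> complex) \<Rightarrow> nat \<Rightarrow> nat \<Rightarrow> complex ^ 2 \<Rightarrow> complex"
    where "low c r j \<zeta> = (case r of 0 \<Rightarrow> 0 | Suc s \<Rightarrow> c (s, off s + j, \<zeta>))" for c r j \<zeta>
  define high :: "(nat \<times> nat \<times> (complex ^ 2) \<Rightarrow> complex) \<Rightarrow> nat \<Rightarrow> nat \<Rightarrow> complex ^ 2 \<Rightarrow> complex"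
    where "high c r j \<zeta> = c (Suc r, j, \<zeta>)" for c r j \<zeta>
  have high: "high c r j \<in> V_carrier (Suc r)" if "c \<in> ?U" "j < m r" for c r j
    unfolding high_def using that by (auto intro!: V_sum_component simp: off)
  have low: "if r = 0 then low c r j = (\<lambda>\<zeta>. 0) else low c r j \<in> V_carrier (r - 1)"
    if "c \<in> ?U" "j < m r" for c r j
    unfolding low_def using that by (cases r) (auto intro!: V_sum_component simp: off)
  define P1 :: "(nat \<times> nat \<times> (complex ^ 2) \<Rightarrow> complex) \<Rightarrow> nat \<times> nat \<times> (complex ^ 2) \<Rightarrow> complex"
    where "P1 c = (\<lambda>(r, j, \<zeta>). if j < m r then partial_deriv 1 (high c r j) \<zeta> - \<zeta> $ 2 * low c r j \<zeta> else 0)" for c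
  define P2 :: "(nat \<times> nat \<times> (complex ^ 2) \<Rightarrow> complex) \<Rightarrow> nat \<times> nat \<times> (complex ^ 2) \<Rightarrow> complex"
    where "P2 c = (\<lambda>(r, j, \<zeta>). if j < m r then partial_deriv 2 (high c r j) \<zeta> + \<zeta> $ 1 * low c r j \<zeta> else 0)" for c
  have P: "P1 c \<in> ?W" "P2 c \<in> ?W" if c: "c \<in> ?U" for c
  proof -
    have *: "(\<lambda>\<zeta>. \<zeta> $ 2 * low c r j \<zeta>) \<in> V_carrier r" "(\<lambda>\<zeta>. \<zeta> $ 1 * low c r j \<zeta>) \<in> V_carrier r"
      if "j < m r" for r j
      using low[OF c that] V_carrier_mult_1[of "low c r j" "r - 1"]
        V_carrier_mult_2[of "low c r j" "r - 1"]
      by (cases r; auto intro: V_carrier_zero)+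
    show "P1 c \<in> ?W" "P2 c \<in> ?W"
      by (auto intro!: V_sum_carrierI V_carrier_diff V_carrier_add * V_carrier_derivative(2,3) high[OF c]
          simp: P1_def P2_def split: if_splits)
  qed
  have P_add: "P1 (c + d) = P1 c + P1 d" "P2 (c + d) = P2 c + P2 d" if "c \<in> ?U" "d \<in> ?U" for c d
  proof -
    have "partial_deriv i (high (c + d) r j) \<zeta> = partial_deriv i (high c r j) \<zeta> + partial_deriv i (high d r j) \<zeta>"
      if "j < m r" for i r j \<zeta>
      using partial_deriv_add[OF high[OF \<open>c \<in> ?U\<close> that] high[OF \<open>d \<in> ?U\<close> that]] by (simp add: high_def[abs_def])
    moreover have "low (c + d) r j \<zeta> = low c r j \<zeta> + low d r j \<zeta>" for r j \<zeta>
      by (simp add: low_def split: nat.split)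
    ultimately show "P1 (c + d) = P1 c + P1 d" "P2 (c + d) = P2 c + P2 d"
      by (auto simp: fun_eq_iff P1_def P2_def algebra_simps)
  qed
  have P_scale: "P1 (fscale a c) = fscale a (P1 c)" "P2 (fscale a c) = fscale a (P2 c)"
    if "c \<in> ?U" for a c
  proof -
    have "partial_deriv i (high (fscale a c) r j) \<zeta> = a * partial_deriv i (high c r j) \<zeta>"
      if "j < m r" for i r j \<zeta>
      using partial_deriv_scale[OF high[OF \<open>c \<in> ?U\<close> that]] by (simp add: high_def[abs_def])
    moreover have "low (fscale a c) r j \<zeta> = a * low c r j \<zeta>" for r j \<zeta>
      by (simp add: low_def split: nat.split)
    ultimately show "P1 (fscale a c) = fscale a (P1 c)" "P2 (fscale a c) = fscale a (P2 c)"
      by (auto simp: fun_eq_iff P1_def P2_def algebra_simps)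
  qed
  have P_action:
    "P1 (V_sum_action q c) = fscale (fst q) (V_sum_action q (P1 c)) + fscale (snd q) (V_sum_action q (P2 c))"
    "P2 (V_sum_action q c) = fscale (- cnj (snd q)) (V_sum_action q (P1 c)) + fscale (cnj (fst q)) (V_sum_action q (P2 c))"
    if "c \<in> ?U" "q \<in> Sp1" for q c
  proof -
    have "high (V_sum_action q c) r j = (\<lambda>\<zeta>. high c r j (\<zeta> v* su2 q))" for r j
      by (simp add: high_def[abs_def] V_sum_action_apply)
    then have pol: "partial_deriv 1 (high (V_sum_action q c) r j) \<zeta> =
        fst q * partial_deriv 1 (high c r j) (\<zeta> v* su2 q) + snd q * partial_deriv 2 (high c r j) (\<zeta> v* su2 q)"
      "partial_deriv 2 (high (V_sum_action q c) r j) \<zeta> =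
        - cnj (snd q) * partial_deriv 1 (high c r j) (\<zeta> v* su2 q) + cnj (fst q) * partial_deriv 2 (high c r j) (\<zeta> v* su2 q)"
      if "j < m r" for r j \<zeta>
      using partial_deriv_action[OF high[OF \<open>c \<in> ?U\<close> that]] by simp_all
    have lo: "low (V_sum_action q c) r j \<zeta> = low c r j (\<zeta> v* su2 q)" for r j \<zeta>
      by (simp add: low_def V_sum_action_apply split: nat.split)
    have det: "fst q * cnj (fst q) + snd q * cnj (snd q) = 1"
      using qmult_qcnj(1)[OF that(2)] by (simp add: qmult_def qcnj_def q_one_def)
    \<comment> \<open>\<open>\<zeta>\<close> is recovered from \<open>\<zeta> g\<close> because \<open>g = su2 q\<close> has determinant 1.\<close>
    have z: "\<zeta> $ 2 = fst q * (\<zeta> v* su2 q) $ 2 - snd q * (\<zeta> v* su2 q) $ 1"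
      "\<zeta> $ 1 = cnj (snd q) * (\<zeta> v* su2 q) $ 2 + cnj (fst q) * (\<zeta> v* su2 q) $ 1" for \<zeta>
    proof -
      have "\<zeta> $ 2 = (fst q * cnj (fst q) + snd q * cnj (snd q)) * \<zeta> $ 2"
        "\<zeta> $ 1 = (fst q * cnj (fst q) + snd q * cnj (snd q)) * \<zeta> $ 1"
        by (simp_all add: det)
      then show "\<zeta> $ 2 = fst q * (\<zeta> v* su2 q) $ 2 - snd q * (\<zeta> v* su2 q) $ 1"
        "\<zeta> $ 1 = cnj (snd q) * (\<zeta> v* su2 q) $ 2 + cnj (fst q) * (\<zeta> v* su2 q) $ 1"
        by (simp_all add: vec_mult_su2 algebra_simps)
    qed
    show "P1 (V_sum_action q c) = fscale (fst q) (V_sum_action q (P1 c)) + fscale (snd q) (V_sum_action q (P2 c))"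
    proof (rule ext, clarify)
      fix r j and \<zeta> :: "complex ^ 2"
      define \<eta> where "\<eta> = \<zeta> v* su2 q"
      have z': "\<zeta> $ 2 = fst q * \<eta> $ 2 - snd q * \<eta> $ 1"
        unfolding \<eta>_def by (rule z)
      show "P1 (V_sum_action q c) (r, j, \<zeta>) =
          (fscale (fst q) (V_sum_action q (P1 c)) + fscale (snd q) (V_sum_action q (P2 c))) (r, j, \<zeta>)"
        by (simp add: P1_def P2_def V_sum_action_apply pol lo z' algebra_simps flip: \<eta>_def)
    qed
    show "P2 (V_sum_action q c) = fscale (- cnj (snd q)) (V_sum_action q (P1 c)) + fscale (cnj (fst q)) (V_sum_action q (P2 c))"
    proof (rule ext, clarify)
      fix r j and \<zeta> :: "complex ^ 2"
      define \<eta> where "\<eta> = \<zeta> v* su2 q"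
      have z': "\<zeta> $ 1 = cnj (snd q) * \<eta> $ 2 + cnj (fst q) * \<eta> $ 1"
        unfolding \<eta>_def by (rule z)
      show "P2 (V_sum_action q c) (r, j, \<zeta>) =
          (fscale (- cnj (snd q)) (V_sum_action q (P1 c)) + fscale (cnj (fst q)) (V_sum_action q (P2 c))) (r, j, \<zeta>)"
        by (simp add: P1_def P2_def V_sum_action_apply pol lo z' algebra_simps flip: \<eta>_def)
    qed
  qed
  have GV: "G (P1 c) \<in> V" "G (P2 c) \<in> V" if "c \<in> ?U" for c
    using P[OF that] G(1) by blast+
  show ?thesis
  proof (rule decomposesI[where G = "\<lambda>c. B1 (G (P1 c)) + B2 (G (P2 c))"])
    show "B1 (G (P1 c)) + B2 (G (P2 c)) \<in> {B1 f + B2 g |f g. f \<in> V \<and> g \<in> V}" if "c \<in> ?U" for c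
      using GV[OF that] by blast
  next
    fix f assume "f \<in> {B1 f + B2 g |f g. f \<in> V \<and> g \<in> V}"
    then obtain c d where cd: "c \<in> ?W" "d \<in> ?W" "f = B1 (G c) + B2 (G d)"
      using G(1) by blast
    define R where "R r j h g \<longleftrightarrow> h \<in> V_carrier (Suc r) \<and>
        (if r = 0 then g = (\<lambda>\<zeta>. 0) else g \<in> V_carrier (r - 1)) \<and>
        (\<forall>\<zeta>. c (r, j, \<zeta>) = partial_deriv 1 h \<zeta> - \<zeta> $ 2 * g \<zeta>) \<and>
        (\<forall>\<zeta>. d (r, j, \<zeta>) = partial_deriv 2 h \<zeta> + \<zeta> $ 1 * g \<zeta>)" for r j h g
    have "\<exists>h g. R r j h g" if "j < m r" for r j
    proof (rule clebsch_gordan_surj[OF V_sum_component[OF cd(1) UNIV_I that] V_sum_component[OF cd(2) UNIV_I that]])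
      fix h g assume "h \<in> V_carrier (Suc r)" "if r = 0 then g = (\<lambda>\<zeta>. 0) else g \<in> V_carrier (r - 1)"
        "\<And>\<zeta>. c (r, j, \<zeta>) = partial_deriv 1 h \<zeta> - \<zeta> $ 2 * g \<zeta>"
        "\<And>\<zeta>. d (r, j, \<zeta>) = partial_deriv 2 h \<zeta> + \<zeta> $ 1 * g \<zeta>"
      then show ?thesis unfolding R_def by (intro exI[of _ h] exI[of _ g]) simp
    qed
    note ex = this
    define h where "h r j = (SOME h. \<exists>g. R r j h g)" for r j
    define g where "g r j = (SOME g. R r j (h r j) g)" for r j
    have Rhg: "R r j (h r j) (g r j)" if "j < m r" for r j
      using someI_ex[OF someI_ex[OF ex[OF that], folded h_def]] by (simp only: g_def)
    have hg: "h r j \<in> V_carrier (Suc r)"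
      "if r = 0 then g r j = (\<lambda>\<zeta>. 0) else g r j \<in> V_carrier (r - 1)"
      "c (r, j, \<zeta>) = partial_deriv 1 (h r j) \<zeta> - \<zeta> $ 2 * g r j \<zeta>"
      "d (r, j, \<zeta>) = partial_deriv 2 (h r j) \<zeta> + \<zeta> $ 1 * g r j \<zeta>" if "j < m r" for r j \<zeta>
      using Rhg[OF that] unfolding R_def by blast+
    define e :: "nat \<times> nat \<times> (complex ^ 2) \<Rightarrow> complex"
      where "e = (\<lambda>(r, j, \<zeta>). if j < off r then h (r - 1) j \<zeta>
        else if j < off r + m (Suc r) then g (Suc r) (j - off r) \<zeta> else 0)"
    have "e \<in> ?U"
    proof (rule V_sum_carrierI)
      fix r j assume j: "j < tensor_V1_mult m r"
      show "(\<lambda>\<zeta>. e (r, j, \<zeta>)) \<in> V_carrier r"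
      proof (cases "j < off r")
        case True
        then obtain s where "r = Suc s" "j < m s" by (cases r) (auto simp: off)
        then show ?thesis using hg(1)[of j s] True by (simp add: e_def)
      next
        case False
        then show ?thesis using hg(2)[of "j - off r" "Suc r"] j by (simp add: e_def off)
      qed
    qed (auto simp: e_def off)
    moreover have hl: "high e r j = h r j" "low e r j = g r j" if "j < m r" for r j
      using that hg(2)[OF that] by (auto simp: fun_eq_iff high_def low_def e_def off split: nat.split)
    have "P1 e (r, j, \<zeta>) = c (r, j, \<zeta>)" "P2 e (r, j, \<zeta>) = d (r, j, \<zeta>)" for r j \<zeta>
      using V_sum_component_zero[OF cd(1), of r j \<zeta>] V_sum_component_zero[OF cd(2), of r j \<zeta>]
      by (cases "j < m r"; simp add: P1_def P2_def hl hg(3,4))+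
    then have "P1 e = c" "P2 e = d"
      by (auto simp only: fun_eq_iff split_paired_all)
    ultimately show "\<exists>c\<in>?U. f = B1 (G (P1 c)) + B2 (G (P2 c))"
      using cd(3) by metis
  next
    show "B1 (G (P1 (c + d))) + B2 (G (P2 (c + d))) =
        B1 (G (P1 c)) + B2 (G (P2 c)) + (B1 (G (P1 d)) + B2 (G (P2 d)))"
      if "c \<in> ?U" "d \<in> ?U" for c d
      using that by (simp add: P P_add G(2) add)
    show "B1 (G (P1 (fscale a c))) + B2 (G (P2 (fscale a c))) = fscale a (B1 (G (P1 c)) + B2 (G (P2 c)))"
      if "c \<in> ?U" for a c
      using that by (simp add: P P_scale G(3) scale fun_eq_iff algebra_simps)
    show "B1 (G (P1 (V_sum_action q c))) + B2 (G (P2 (V_sum_action q c))) =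
        \<rho> q (B1 (G (P1 c)) + B2 (G (P2 c)))"
      if "q \<in> Sp1" "c \<in> ?U" for q c
      using that by (simp add: P P_action G(2,3,4) V_sum_scale V_sum_action_closed equiv GV)
  next
    fix c assume c: "c \<in> ?U" "B1 (G (P1 c)) + B2 (G (P2 c)) = 0"
    then have P0: "P1 c = 0" "P2 c = 0"
      using inj[OF GV[OF c(1)]] G(5) P by blast+
    have hl: "high c r j \<zeta> = 0" "low c r j \<zeta> = 0" if j: "j < m r" for r j \<zeta>
    proof -
      have "partial_deriv 1 (high c r j) \<zeta> = \<zeta> $ 2 * low c r j \<zeta>"
        "partial_deriv 2 (high c r j) \<zeta> = - (\<zeta> $ 1 * low c r j \<zeta>)" for \<zeta>
        using fun_cong[OF P0(1), of "(r, j, \<zeta>)"] fun_cong[OF P0(2), of "(r, j, \<zeta>)"] j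
        by (simp_all add: P1_def P2_def eq_neg_iff_add_eq_0)
      moreover have "low c r j \<in> V_carrier (r - 1)"
        using low[OF c(1) j] V_carrier_zero by (auto split: if_splits)
      ultimately show "high c r j \<zeta> = 0" "low c r j \<zeta> = 0"
        using clebsch_gordan_inj[OF high[OF c(1) j]] by blast+
    qed
    show "c = 0"
    proof (rule ext, clarify)
      fix r j and \<zeta> :: "complex ^ 2"
      consider s where "r = Suc s" "j < m s" | j' where "j = off r + j'" "j' < m (Suc r)"
        | "\<not> j < off r + m (Suc r)"
      proof (cases "j < off r")
        case True
        then show ?thesis using that(1) by (cases r) (auto simp: off)
      next
        case False
        then show ?thesis using that(2)[of "j - off r"] that(3) by fastforce
      qed
      then show "c (r, j, \<zeta>) = 0 (r, j, \<zeta>)"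
      proof cases
        case 1
        then show ?thesis using hl(1)[of j s \<zeta>] by (simp add: high_def)
      next
        case 2
        then show ?thesis using hl(2)[of j' "Suc r" \<zeta>] by (simp add: low_def)
      next
        case 3
        then show ?thesis using V_sum_component_zero[OF c(1)] by (simp add: off)
      qed
    qed
  qed
qed

section \<open>Alternating forms on real vector spaces\<close>

text \<open>
  Forms of all degrees at once, as functions on lists of vectors; it is enough to ask that two equal
  \<^emph>\<open>adjacent\<close> arguments give zero (\<open>alternating_repeated\<close>).
\<close>

definition alternating :: "('v::real_vector list \<Rightarrow> complex) \<Rightarrow> bool" where
  "alternating \<omega> \<longleftrightarrow>
     (\<forall>us vs v w. \<omega> (us @ (v + w) # vs) = \<omega> (us @ v # vs) + \<omega> (us @ w # vs)) \<and>
     (\<forall>us vs v a. \<omega> (us @ (a *\<^sub>R v) # vs) = of_real a * \<omega> (us @ v # vs)) \<and>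
     (\<forall>us vs v. \<omega> (us @ v # v # vs) = 0)"

lemma alternatingD:
  assumes "alternating \<omega>"
  shows "\<omega> (us @ (v + w) # vs) = \<omega> (us @ v # vs) + \<omega> (us @ w # vs)"
    "\<omega> (us @ (a *\<^sub>R v) # vs) = of_real a * \<omega> (us @ v # vs)"
    "\<omega> (us @ v # v # vs) = 0"
  using assms by (auto simp: alternating_def)

lemma alternatingI:
  assumes "\<And>us vs v w. \<omega> (us @ (v + w) # vs) = \<omega> (us @ v # vs) + \<omega> (us @ w # vs)"
    "\<And>us vs v a. \<omega> (us @ (a *\<^sub>R v) # vs) = of_real a * \<omega> (us @ v # vs)"
    "\<And>us vs v. \<omega> (us @ v # v # vs) = 0"
  shows "alternating \<omega>"
  using assms by (auto simp: alternating_def)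

lemma alternating_swap:
  assumes "alternating \<omega>"
  shows "\<omega> (us @ v # w # vs) = - \<omega> (us @ w # v # vs)"
proof -
  note D = alternatingD[OF assms]
  have "0 = \<omega> (us @ (v + w) # (v + w) # vs)"
    by (simp add: D)
  also have "\<dots> = \<omega> (us @ v # (v + w) # vs) + \<omega> (us @ w # (v + w) # vs)"
    by (rule D)
  also have "\<dots> = \<omega> (us @ v # w # vs) + \<omega> (us @ w # v # vs)"
    using D(1)[of "us @ [v]" v w vs] D(1)[of "us @ [w]" v w vs] by (simp add: D(3))
  finally show ?thesis
    by (simp add: eq_neg_iff_add_eq_0)
qed

lemma alternating_repeated:
  assumes "alternating \<omega>"
  shows "\<omega> (us @ v # ws @ v # vs) = 0"
proof (induction ws arbitrary: us)
  case Nil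
  then show ?case by (simp add: alternatingD[OF assms])
next
  case (Cons w ws)
  show ?case
    using Cons[of "us @ [w]"] alternating_swap[OF assms, of us v w] by simp
qed

lemma alternating_add: "alternating \<omega> \<Longrightarrow> alternating \<omega>' \<Longrightarrow> alternating (\<omega> + \<omega>')"
  by (intro alternatingI) (simp_all add: alternatingD algebra_simps)

lemma alternating_scale: "alternating \<omega> \<Longrightarrow> alternating (fscale a \<omega>)"
  by (intro alternatingI) (simp_all add: alternatingD algebra_simps)

lemma alternating_interior: "alternating \<omega> \<Longrightarrow> alternating (\<lambda>vs. \<omega> (u # vs))"
proof (rule alternatingI)
  assume *: "alternating \<omega>"
  fix us vs v w and a :: real
  show "\<omega> (u # us @ (v + w) # vs) = \<omega> (u # us @ v # vs) + \<omega> (u # us @ w # vs)"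
    using alternatingD(1)[OF *, of "u # us"] by simp
  show "\<omega> (u # us @ (a *\<^sub>R v) # vs) = of_real a * \<omega> (u # us @ v # vs)"
    using alternatingD(2)[OF *, of "u # us"] by simp
  show "\<omega> (u # us @ v # v # vs) = 0"
    using alternatingD(3)[OF *, of "u # us"] by simp
qed

text \<open>
  Exterior product of a covector with a form. The recursion is the antiderivation rule
  \<open>\<iota>\<^sub>v(\<beta> \<and> \<omega>) = \<beta>(v) \<omega> - \<beta> \<and> \<iota>\<^sub>v\<omega>\<close>, so that most properties of the product follow by induction on
  the argument list, with \<open>\<omega>\<close> arbitrary.
\<close>

fun wedge :: "('v \<Rightarrow> complex) \<Rightarrow> ('v list \<Rightarrow> complex) \<Rightarrow> 'v list \<Rightarrow> complex" where
  "wedge \<beta> \<omega> [] = 0"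
| "wedge \<beta> \<omega> (v # vs) = \<beta> v * \<omega> vs - wedge \<beta> (\<lambda>ws. \<omega> (v # ws)) vs"

lemma wedge_lincomb:
  "wedge \<beta> (\<lambda>vs. a * \<omega> vs + b * \<omega>' vs) vs = a * wedge \<beta> \<omega> vs + b * wedge \<beta> \<omega>' vs"
  by (induction vs arbitrary: \<omega> \<omega>') (simp_all add: algebra_simps)

lemma wedge_lincomb_left:
  "wedge (\<lambda>v. a * \<alpha> v + b * \<beta> v) \<omega> vs = a * wedge \<alpha> \<omega> vs + b * wedge \<beta> \<omega> vs"
  by (induction vs arbitrary: \<omega>) (simp_all add: algebra_simps)

lemma wedge_add: "wedge \<beta> (\<omega> + \<omega>') = wedge \<beta> \<omega> + wedge \<beta> \<omega>'"
  using wedge_lincomb[of \<beta> 1 \<omega> 1 \<omega>'] by (simp add: fun_eq_iff plus_fun_def)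

lemma wedge_scale: "wedge \<beta> (fscale a \<omega>) = fscale a (wedge \<beta> \<omega>)"
  using wedge_lincomb[of \<beta> a \<omega> 0 \<omega>] by (simp add: fun_eq_iff fscale_def)

lemma wedge_zero: "wedge \<beta> 0 = 0"
  using wedge_scale[of \<beta> 0 0] by (simp add: fscale_def zero_fun_def)

lemma wedge_anticommute: "wedge \<alpha> (wedge \<beta> \<omega>) = fscale (-1) (wedge \<beta> (wedge \<alpha> \<omega>))"
proof
  have *: "wedge \<alpha> (\<lambda>ws. a * \<omega> ws - \<omega>' ws) vs = a * wedge \<alpha> \<omega> vs - wedge \<alpha> \<omega>' vs"
    for \<alpha> :: "'a \<Rightarrow> complex" and a \<omega> \<omega>' vs
    using wedge_lincomb[of \<alpha> a \<omega> "-1" \<omega>' vs] by simp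
  show "wedge \<alpha> (wedge \<beta> \<omega>) vs = fscale (-1) (wedge \<beta> (wedge \<alpha> \<omega>)) vs" for vs
  proof (induction vs arbitrary: \<omega>)
    case (Cons v vs)
    then show ?case by (simp add: *)
  qed simp
qed

lemma wedge_self: "wedge \<alpha> (wedge \<alpha> \<omega>) = 0"
  using wedge_anticommute[of \<alpha> \<alpha> \<omega>] by (simp add: fun_eq_iff)

lemma wedge_pullback: "wedge \<beta> \<omega> (map g vs) = wedge (\<lambda>v. \<beta> (g v)) (\<lambda>vs. \<omega> (map g vs)) vs"
  by (induction vs arbitrary: \<omega>) simp_all

lemma alternating_wedge:
  assumes "\<And>v w. \<beta> (v + w) = \<beta> v + \<beta> w" "\<And>a v. \<beta> (a *\<^sub>R v) = of_real a * \<beta> v"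
    and "alternating \<omega>"
  shows "alternating (wedge \<beta> \<omega>)"
proof (rule alternatingI)
  fix us vs v w and a :: real
  have lincomb: "wedge \<beta> (\<lambda>ws. \<omega> ws + \<omega>' ws) vs = wedge \<beta> \<omega> vs + wedge \<beta> \<omega>' vs"
    "wedge \<beta> (\<lambda>ws. a * \<omega> ws) vs = a * wedge \<beta> \<omega> vs"
    "wedge \<beta> (\<lambda>ws. a * \<omega> ws - \<omega>' ws) vs = a * wedge \<beta> \<omega> vs - wedge \<beta> \<omega>' vs" for a \<omega> \<omega>' vs
    using wedge_lincomb[of \<beta> 1 \<omega> 1 \<omega>' vs] wedge_lincomb[of \<beta> a \<omega> 0 \<omega>' vs]
      wedge_lincomb[of \<beta> a \<omega> "-1" \<omega>' vs] by simp_all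
  show "wedge \<beta> \<omega> (us @ (v + w) # vs) = wedge \<beta> \<omega> (us @ v # vs) + wedge \<beta> \<omega> (us @ w # vs)"
    using assms(3)
  proof (induction us arbitrary: \<omega>)
    case Nil
    then show ?case using alternatingD(1)[OF Nil, of "[]"]
      by (simp add: assms(1) algebra_simps lincomb)
  next
    case (Cons u us)
    then show ?case
      using alternatingD(1)[OF Cons.prems] alternating_interior[OF Cons.prems]
      by (simp add: algebra_simps)
  qed
  show "wedge \<beta> \<omega> (us @ (a *\<^sub>R v) # vs) = of_real a * wedge \<beta> \<omega> (us @ v # vs)"
    using assms(3)
  proof (induction us arbitrary: \<omega>)
    case Nil
    then show ?case using alternatingD(2)[OF Nil, of "[]"]
      by (simp add: assms(2) algebra_simps lincomb)
  next
    case (Cons u us)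
    then show ?case
      using alternatingD(2)[OF Cons.prems] alternating_interior[OF Cons.prems]
      by (simp add: algebra_simps)
  qed
  show "wedge \<beta> \<omega> (us @ v # v # vs) = 0"
    using assms(3)
  proof (induction us arbitrary: \<omega>)
    case Nil
    have "(\<lambda>ws. \<omega> (v # v # ws)) = 0"
      using alternatingD(3)[OF Nil, of "[]"] by (simp add: fun_eq_iff)
    then show ?case
      by (simp add: lincomb wedge_zero)
  next
    case (Cons u us)
    then show ?case
      using alternatingD(3)[OF Cons.prems] alternating_interior[OF Cons.prems]
      by simp
  qed
qed

text \<open>
  Degrees are integers, so that the recursion over doublets need not treat degrees 0 and 1 separately:
  a form of negative degree is zero.
\<close>

definition homogeneous :: "int \<Rightarrow> ('v list \<Rightarrow> complex) \<Rightarrow> bool" where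
  "homogeneous k \<omega> \<longleftrightarrow> (\<forall>vs. int (length vs) \<noteq> k \<longrightarrow> \<omega> vs = 0)"

lemma homogeneous_wedge: "homogeneous k \<omega> \<Longrightarrow> homogeneous (k + 1) (wedge \<beta> \<omega>)"
proof -
  have "wedge \<beta> \<omega> vs = 0" if "homogeneous k \<omega>" "int (length vs) \<noteq> k + 1" for vs
    using that
  proof (induction vs arbitrary: k \<omega>)
    case (Cons v vs)
    have "homogeneous (k - 1) (\<lambda>ws. \<omega> (v # ws))"
      using Cons.prems(1) by (simp add: homogeneous_def)
    then have "wedge \<beta> (\<lambda>ws. \<omega> (v # ws)) vs = 0"
      using Cons.prems(2) by (intro Cons.IH[of "k - 1"]) auto
    then show ?case using Cons.prems by (simp add: homogeneous_def)
  qed simp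
  then show "homogeneous k \<omega> \<Longrightarrow> homogeneous (k + 1) (wedge \<beta> \<omega>)"
    by (simp add: homogeneous_def)
qed

text \<open>
  Contraction with the complexified vector \<open>fst e + \<i> snd e\<close>.
\<close>

definition contract :: "'v \<times> 'v \<Rightarrow> ('v list \<Rightarrow> complex) \<Rightarrow> 'v list \<Rightarrow> complex" where
  "contract e \<omega> vs = \<omega> (fst e # vs) + \<i> * \<omega> (snd e # vs)"

lemma contract_add: "contract e (\<omega> + \<omega>') = contract e \<omega> + contract e \<omega>'"
  by (simp add: fun_eq_iff contract_def algebra_simps)

lemma contract_scale: "contract e (fscale a \<omega>) = fscale a (contract e \<omega>)"
  by (simp add: fun_eq_iff contract_def algebra_simps)

lemma contract_zero: "contract e 0 = 0"
  by (simp add: fun_eq_iff contract_def)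

lemma contract_wedge:
  "contract e (wedge \<beta> \<omega>) =
    fscale (\<beta> (fst e) + \<i> * \<beta> (snd e)) \<omega> + fscale (-1) (wedge \<beta> (contract e \<omega>))"
proof
  fix vs
  have "contract e \<omega> = (\<lambda>ws. 1 * \<omega> (fst e # ws) + \<i> * \<omega> (snd e # ws))"
    by (rule ext) (simp only: contract_def mult_1)
  then have "wedge \<beta> (contract e \<omega>) vs =
      1 * wedge \<beta> (\<lambda>ws. \<omega> (fst e # ws)) vs + \<i> * wedge \<beta> (\<lambda>ws. \<omega> (snd e # ws)) vs"
    by (simp only: wedge_lincomb)
  moreover have "(a * x - p) + \<i> * (b * x - q) = (a + \<i> * b) * x + (-1) * (1 * p + \<i> * q)"
    for a b x p q :: complex
    by (simp add: algebra_simps)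
  ultimately show "contract e (wedge \<beta> \<omega>) vs =
      (fscale (\<beta> (fst e) + \<i> * \<beta> (snd e)) \<omega> + fscale (-1) (wedge \<beta> (contract e \<omega>))) vs"
    by (simp only: contract_def[of e "wedge \<beta> \<omega>"] plus_fun_apply fscale_apply wedge.simps)
qed

lemma contract_anticommute:
  assumes "alternating \<omega>"
  shows "contract e (contract e' \<omega>) = fscale (-1) (contract e' (contract e \<omega>))"
proof -
  have swap: "\<omega> (v # w # vs) = - \<omega> (w # v # vs)" for v w vs
    using alternating_swap[OF assms, of "[]" v w vs] unfolding append_Nil .
  show ?thesis
    unfolding fun_eq_iff contract_def fscale_apply swap[of "fst e'" "fst e"]
        swap[of "fst e'" "snd e"] swap[of "snd e'" "fst e"] swap[of "snd e'" "snd e"]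
    by (simp add: algebra_simps)
qed

lemma complex_eq_minus_self: "(x :: complex) = - x \<Longrightarrow> x = 0"
  unfolding eq_neg_iff_add_eq_0 mult_2[symmetric] by simp

lemma contract_self: "alternating \<omega> \<Longrightarrow> contract e (contract e \<omega>) = 0"
proof
  assume "alternating \<omega>"
  note * = fun_cong[OF contract_anticommute[OF this, of e e]]
  show "contract e (contract e \<omega>) vs = 0 vs" for vs
    unfolding zero_fun_apply
    by (rule complex_eq_minus_self) (rule *[unfolded fscale_apply mult_minus1])
qed

lemma alternating_contract: "alternating \<omega> \<Longrightarrow> alternating (contract e \<omega>)"
proof -
  assume *: "alternating \<omega>"
  have "contract e \<omega> = (\<lambda>vs. \<omega> (fst e # vs)) + fscale \<i> (\<lambda>vs. \<omega> (snd e # vs))"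
    by (simp add: fun_eq_iff contract_def)
  then show ?thesis
    using * by (simp add: alternating_add alternating_scale alternating_interior)
qed

lemma homogeneous_contract: "homogeneous k \<omega> \<Longrightarrow> homogeneous (k - 1) (contract e \<omega>)"
  by (simp add: homogeneous_def contract_def)

lemma fscale_simps [simp]: "fscale 0 f = 0" "fscale 1 f = f" "fscale a 0 = 0"
  by (simp_all add: fun_eq_iff)

lemma fscale_fscale [simp]: "fscale a (fscale b f) = fscale (a * b) f"
  by (simp add: fun_eq_iff)

section \<open>Decomposing the exterior algebra of a sum of doublets\<close>

text \<open>
  The multiplicity of \<open>V\<^sub>r\<close> in the degree \<open>k\<close> part of the exterior algebra of the sum of \<open>N\<close> doublets.
\<close>

fun V_multiplicity :: "nat \<Rightarrow> int \<Rightarrow> nat \<Rightarrow> nat" where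
  "V_multiplicity 0 k r = (if k = 0 \<and> r = 0 then 1 else 0)"
| "V_multiplicity (Suc N) k r = V_multiplicity N k r + V_multiplicity N (k - 2) r + tensor_V1_mult (V_multiplicity N (k - 1)) r"

text \<open>
  The pairs \<open>(\<beta>1 t, \<beta>2 t)\<close> form a complex basis of the real-linear functionals on \<open>'v\<close>, with dual basis
  \<open>(e1 t, e2 t)\<close> of the complexification; that the dual vectors span is expressed by the property \<open>spanning\<close>, the form in
  which it is used. \<open>L q\<close> is the action of the \<^emph>\<open>inverse\<close> of \<open>q\<close>, so composition with it is
  a left action, under which each pair transforms like the coordinates \<open>\<zeta>\<^sub>1, \<zeta>\<^sub>2\<close> on row vectors.
\<close>

locale doublets =
  fixes \<beta>1 \<beta>2 :: "'t::finite \<Rightarrow> 'v::real_vector \<Rightarrow> complex"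
    and e1 e2 :: "'t \<Rightarrow> 'v \<times> 'v"
    and L :: "quat \<Rightarrow> 'v \<Rightarrow> 'v"
  assumes \<beta>_add: "\<beta>1 t (v + w) = \<beta>1 t v + \<beta>1 t w" "\<beta>2 t (v + w) = \<beta>2 t v + \<beta>2 t w"
    and \<beta>_scale: "\<beta>1 t (a *\<^sub>R v) = of_real a * \<beta>1 t v" "\<beta>2 t (a *\<^sub>R v) = of_real a * \<beta>2 t v"
    and dual: "\<beta>1 t (fst (e1 s)) + \<i> * \<beta>1 t (snd (e1 s)) = (if s = t then 1 else 0)"
      "\<beta>1 t (fst (e2 s)) + \<i> * \<beta>1 t (snd (e2 s)) = 0"
      "\<beta>2 t (fst (e1 s)) + \<i> * \<beta>2 t (snd (e1 s)) = 0"
      "\<beta>2 t (fst (e2 s)) + \<i> * \<beta>2 t (snd (e2 s)) = (if s = t then 1 else 0)"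
    and spanning: "alternating \<omega> \<Longrightarrow> (\<And>t. contract (e1 t) \<omega> = 0) \<Longrightarrow> (\<And>t. contract (e2 t) \<omega> = 0) \<Longrightarrow>
      \<omega> (v # vs) = 0"
    and doublet: "q \<in> Sp1 \<Longrightarrow> \<beta>1 t (L q v) = fst q * \<beta>1 t v - cnj (snd q) * \<beta>2 t v"
      "q \<in> Sp1 \<Longrightarrow> \<beta>2 t (L q v) = snd q * \<beta>1 t v + cnj (fst q) * \<beta>2 t v"
begin

definition act :: "quat \<Rightarrow> ('v list \<Rightarrow> complex) \<Rightarrow> 'v list \<Rightarrow> complex" where
  "act q \<omega> vs = \<omega> (map (L q) vs)"

lemma act_add: "act q (\<omega> + \<omega>') = act q \<omega> + act q \<omega>'"
  by (simp add: fun_eq_iff act_def)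

lemma act_wedge:
  assumes "q \<in> Sp1"
  shows "act q (wedge (\<beta>1 t) \<omega>) =
      fscale (fst q) (wedge (\<beta>1 t) (act q \<omega>)) + fscale (- cnj (snd q)) (wedge (\<beta>2 t) (act q \<omega>))"
    "act q (wedge (\<beta>2 t) \<omega>) =
      fscale (snd q) (wedge (\<beta>1 t) (act q \<omega>)) + fscale (cnj (fst q)) (wedge (\<beta>2 t) (act q \<omega>))"
proof -
  have "(\<lambda>v. \<beta>1 t (L q v)) = (\<lambda>v. fst q * \<beta>1 t v + (- cnj (snd q)) * \<beta>2 t v)"
    "(\<lambda>v. \<beta>2 t (L q v)) = (\<lambda>v. snd q * \<beta>1 t v + cnj (fst q) * \<beta>2 t v)"
    using assms by (simp_all add: doublet)
  note \<beta>L = this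
  have pull: "act q (wedge \<beta> \<omega>) = wedge (\<lambda>v. \<beta> (L q v)) (act q \<omega>)" for \<beta>
    by (rule ext) (simp only: act_def[abs_def] wedge_pullback)
  show "act q (wedge (\<beta>1 t) \<omega>) =
      fscale (fst q) (wedge (\<beta>1 t) (act q \<omega>)) + fscale (- cnj (snd q)) (wedge (\<beta>2 t) (act q \<omega>))"
    "act q (wedge (\<beta>2 t) \<omega>) =
      fscale (snd q) (wedge (\<beta>1 t) (act q \<omega>)) + fscale (cnj (fst q)) (wedge (\<beta>2 t) (act q \<omega>))"
    unfolding pull \<beta>L by (rule ext, simp only: wedge_lincomb_left plus_fun_apply fscale_apply)+
qed

text \<open>
  The degree \<open>k\<close> part of the exterior algebra generated by the doublets in \<open>S\<close>, characterised by contractions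
  so that for \<open>S = UNIV\<close>, where the last condition is void, these are all alternating forms.
\<close>

definition forms_on :: "'t set \<Rightarrow> int \<Rightarrow> ('v list \<Rightarrow> complex) set" where
  "forms_on S k = {\<omega>. alternating \<omega> \<and> homogeneous k \<omega> \<and>
     (\<forall>t. t \<notin> S \<longrightarrow> contract (e1 t) \<omega> = 0 \<and> contract (e2 t) \<omega> = 0)}"

lemma forms_on_add: "\<omega> \<in> forms_on S k \<Longrightarrow> \<omega>' \<in> forms_on S k \<Longrightarrow> \<omega> + \<omega>' \<in> forms_on S k"
  by (auto simp: forms_on_def alternating_add contract_add homogeneous_def)

lemma forms_on_scale: "\<omega> \<in> forms_on S k \<Longrightarrow> fscale a \<omega> \<in> forms_on S k"
  by (auto simp: forms_on_def alternating_scale contract_scale homogeneous_def)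

lemma forms_on_contract:
  assumes "\<omega> \<in> forms_on S k"
  shows "contract e \<omega> \<in> forms_on S (k - 1)"
proof -
  have "contract e' (contract e \<omega>) = 0" if "contract e' \<omega> = 0" for e'
  proof -
    have "alternating \<omega>" using assms by (simp add: forms_on_def)
    then have "contract e' (contract e \<omega>) = fscale (-1) (contract e (contract e' \<omega>))"
      by (rule contract_anticommute)
    also have "\<dots> = 0"
      unfolding that contract_zero by simp
    finally show ?thesis .
  qed
  then show ?thesis
    using assms by (auto simp: forms_on_def alternating_contract homogeneous_contract)
qed

lemma contract_wedge_doublet:
  "contract (e1 s) (wedge (\<beta>1 t) \<omega>) = (if s = t then \<omega> else 0) + fscale (-1) (wedge (\<beta>1 t) (contract (e1 s) \<omega>))"
  "contract (e2 s) (wedge (\<beta>1 t) \<omega>) = fscale (-1) (wedge (\<beta>1 t) (contract (e2 s) \<omega>))"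
  "contract (e1 s) (wedge (\<beta>2 t) \<omega>) = fscale (-1) (wedge (\<beta>2 t) (contract (e1 s) \<omega>))"
  "contract (e2 s) (wedge (\<beta>2 t) \<omega>) = (if s = t then \<omega> else 0) + fscale (-1) (wedge (\<beta>2 t) (contract (e2 s) \<omega>))"
  unfolding contract_wedge dual by simp_all

lemma forms_on_wedge:
  assumes \<omega>: "\<omega> \<in> forms_on S k" and t: "t \<in> S"
  shows "wedge (\<beta>1 t) \<omega> \<in> forms_on S (k + 1)" "wedge (\<beta>2 t) \<omega> \<in> forms_on S (k + 1)"
proof -
  have *: "alternating \<omega>" "homogeneous k \<omega>"
    "\<And>s. s \<notin> S \<Longrightarrow> contract (e1 s) \<omega> = 0" "\<And>s. s \<notin> S \<Longrightarrow> contract (e2 s) \<omega> = 0"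
    using \<omega> by (simp_all add: forms_on_def)
  have "alternating (wedge (\<beta>1 t) \<omega>)" "alternating (wedge (\<beta>2 t) \<omega>)"
    by (rule alternating_wedge[OF _ _ *(1)]; simp add: \<beta>_add \<beta>_scale)+
  moreover have "contract (e1 s) (wedge (\<beta>1 t) \<omega>) = 0" "contract (e2 s) (wedge (\<beta>1 t) \<omega>) = 0"
    "contract (e1 s) (wedge (\<beta>2 t) \<omega>) = 0" "contract (e2 s) (wedge (\<beta>2 t) \<omega>) = 0" if s: "s \<notin> S" for s
  proof -
    have "s \<noteq> t" using s t by blast
    then show "contract (e1 s) (wedge (\<beta>1 t) \<omega>) = 0" "contract (e2 s) (wedge (\<beta>1 t) \<omega>) = 0"
      "contract (e1 s) (wedge (\<beta>2 t) \<omega>) = 0" "contract (e2 s) (wedge (\<beta>2 t) \<omega>) = 0"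
      by (simp_all add: contract_wedge_doublet *(3,4)[OF s] wedge_zero)
  qed
  ultimately show "wedge (\<beta>1 t) \<omega> \<in> forms_on S (k + 1)" "wedge (\<beta>2 t) \<omega> \<in> forms_on S (k + 1)"
    using homogeneous_wedge[OF *(2)] by (simp_all add: forms_on_def)
qed

lemma forms_on_iff:
  assumes "t \<notin> S"
  shows "\<omega> \<in> forms_on S k \<longleftrightarrow>
    \<omega> \<in> forms_on (insert t S) k \<and> contract (e1 t) \<omega> = 0 \<and> contract (e2 t) \<omega> = 0"
  using assms by (auto simp: forms_on_def)

lemma forms_on_contract_zero:
  assumes "\<omega> \<in> forms_on S k" "t \<notin> S"
  shows "contract (e1 t) \<omega> = 0" "contract (e2 t) \<omega> = 0"
  using assms by (auto simp: forms_on_def)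

lemma contract_doublet:
  assumes "\<omega> \<in> forms_on S k" "t \<notin> S"
  shows "contract (e1 t) (wedge (\<beta>1 t) \<omega>) = \<omega>" "contract (e2 t) (wedge (\<beta>1 t) \<omega>) = 0"
    "contract (e1 t) (wedge (\<beta>2 t) \<omega>) = 0" "contract (e2 t) (wedge (\<beta>2 t) \<omega>) = \<omega>"
    "contract (e1 t) (wedge (\<beta>1 t) (wedge (\<beta>2 t) \<omega>)) = wedge (\<beta>2 t) \<omega>"
    "contract (e2 t) (wedge (\<beta>1 t) (wedge (\<beta>2 t) \<omega>)) = fscale (-1) (wedge (\<beta>1 t) \<omega>)"
  using forms_on_contract_zero[OF assms]
  by (simp_all add: contract_wedge_doublet wedge_zero)

text \<open>
  The components of \<open>\<omega> = a + \<beta>1 \<and> \<beta>2 \<and> c + (\<beta>1 \<and> b1 + \<beta>2 \<and> b2)\<close> are read off by contraction: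
  \<open>\<iota>\<^sub>1\<omega> = b1 + \<beta>2 \<and> c\<close>, \<open>\<iota>\<^sub>2\<omega> = b2 - \<beta>1 \<and> c\<close> and \<open>\<iota>\<^sub>2\<iota>\<^sub>1\<omega> = c\<close>.
\<close>

lemma forms_on_insert:
  assumes t: "t \<notin> S"
  shows "forms_on (insert t S) k =
    {f + g |f g. f \<in> {f + g |f g. f \<in> forms_on S k \<and>
        g \<in> (\<lambda>\<omega>. wedge (\<beta>1 t) (wedge (\<beta>2 t) \<omega>)) ` forms_on S (k - 2)} \<and>
      g \<in> {wedge (\<beta>1 t) f + wedge (\<beta>2 t) g |f g. f \<in> forms_on S (k - 1) \<and> g \<in> forms_on S (k - 1)}}"
    (is "_ = ?R")
proof
  note sub = iffD1[OF forms_on_iff[OF t], THEN conjunct1]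
  have w: "wedge (\<beta>1 t) \<omega> \<in> forms_on (insert t S) l" "wedge (\<beta>2 t) \<omega> \<in> forms_on (insert t S) l"
    if "\<omega> \<in> forms_on (insert t S) (l - 1)" for \<omega> l
    using forms_on_wedge[OF that] by simp_all
  show "?R \<subseteq> forms_on (insert t S) k"
  proof clarify
    fix a c b1 b2
    assume "a \<in> forms_on S k" "c \<in> forms_on S (k - 2)" "b1 \<in> forms_on S (k - 1)" "b2 \<in> forms_on S (k - 1)"
    from this[THEN sub] show "a + wedge (\<beta>1 t) (wedge (\<beta>2 t) c) + (wedge (\<beta>1 t) b1 + wedge (\<beta>2 t) b2)
        \<in> forms_on (insert t S) k"
      by (intro forms_on_add w) (simp_all add: algebra_simps)
  qed
  show "forms_on (insert t S) k \<subseteq> ?R"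
  proof
    fix \<omega> assume \<omega>: "\<omega> \<in> forms_on (insert t S) k"
    then have alt: "alternating \<omega>" by (simp add: forms_on_def)
    define c where "c = contract (e2 t) (contract (e1 t) \<omega>)"
    define b1 where "b1 = contract (e1 t) \<omega> + fscale (-1) (wedge (\<beta>2 t) c)"
    define b2 where "b2 = contract (e2 t) \<omega> + wedge (\<beta>1 t) c"
    define a where "a = \<omega> + fscale (-1) (wedge (\<beta>1 t) (wedge (\<beta>2 t) c) + (wedge (\<beta>1 t) b1 + wedge (\<beta>2 t) b2))"
    have c': "c \<in> forms_on (insert t S) (k - 2)"
      using forms_on_contract[OF forms_on_contract[OF \<omega>]] by (simp add: c_def)
    have "contract (e1 t) c = 0" "contract (e2 t) c = 0"
      unfolding c_def contract_self[OF alternating_contract[OF alt]]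
        contract_anticommute[OF alternating_contract[OF alt], of "e1 t" "e2 t"] contract_self[OF alt]
      by (simp_all add: contract_zero)
    then have c: "c \<in> forms_on S (k - 2)"
      using c' forms_on_iff[OF t] by blast
    note cd = contract_doublet[OF c t]
    have b': "b1 \<in> forms_on (insert t S) (k - 1)" "b2 \<in> forms_on (insert t S) (k - 1)"
      using c' forms_on_contract[OF \<omega>, of "e1 t"] forms_on_contract[OF \<omega>, of "e2 t"]
      unfolding b1_def b2_def by (auto intro!: forms_on_add forms_on_scale w simp: algebra_simps)
    have "contract (e1 t) b1 = 0" "contract (e2 t) b1 = 0" "contract (e1 t) b2 = 0" "contract (e2 t) b2 = 0"
      unfolding b1_def b2_def contract_add contract_scale cd
      by (simp_all add: contract_self[OF alt] c_def contract_anticommute[OF alt, of "e1 t" "e2 t"] fun_eq_iff)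
    then have b: "b1 \<in> forms_on S (k - 1)" "b2 \<in> forms_on S (k - 1)"
      using b' forms_on_iff[OF t] by blast+
    have a': "a \<in> forms_on (insert t S) k"
      unfolding a_def using \<omega> c' b'
      by (intro forms_on_add forms_on_scale w) (simp_all add: algebra_simps)
    have "contract (e1 t) a = 0" "contract (e2 t) a = 0"
      unfolding a_def contract_add contract_scale cd contract_doublet[OF b(1) t] contract_doublet[OF b(2) t]
      by (simp_all add: b1_def b2_def fun_eq_iff)
    then have a: "a \<in> forms_on S k"
      using a' forms_on_iff[OF t] by blast
    have "\<omega> = a + wedge (\<beta>1 t) (wedge (\<beta>2 t) c) + (wedge (\<beta>1 t) b1 + wedge (\<beta>2 t) b2)"
      by (simp add: a_def fun_eq_iff)
    with a b c show "\<omega> \<in> ?R" by blast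
  qed
qed

text \<open>
  A form killed by all contractions vanishes on nonempty lists, so is a scalar in degree 0, and Sp(1)
  fixes scalars.
\<close>

lemma decomposes_forms_on_empty: "decomposes act (V_multiplicity 0 k) (forms_on {} k)"
proof (rule decomposesI[where G = "\<lambda>c vs. if vs = [] then c (0, 0, 0) else 0"])
  fix c assume c: "c \<in> V_sum_carrier UNIV (V_multiplicity 0 k)"
  have "c (0, 0, 0) = 0" if "k \<noteq> 0"
    using V_sum_component_zero[OF c, of 0 0] that by simp
  then show "(\<lambda>vs. if vs = [] then c (0, 0, 0) else 0) \<in> forms_on {} k"
    by (auto simp: forms_on_def alternating_def homogeneous_def contract_def fun_eq_iff)
  have const: "\<exists>z. \<forall>\<zeta>. c (0, 0, \<zeta>) = z"
  proof (cases "k = 0")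
    case True
    then have "(\<lambda>\<zeta>. c (0, 0, \<zeta>)) \<in> V_carrier 0"
      by (intro V_sum_component[OF c]) auto
    then show ?thesis by (auto simp: V_carrier_def fun_eq_iff)
  next
    case False
    then show ?thesis using V_sum_component_zero[OF c, of 0 0] by simp
  qed
  then show "(\<lambda>vs. if vs = [] then V_sum_action q c (0, 0, 0) else 0) =
      act q (\<lambda>vs. if vs = [] then c (0, 0, 0) else 0)" for q
    by (auto simp: fun_eq_iff act_def V_sum_action_apply)
  assume *: "(\<lambda>vs::'v list. if vs = [] then c (0, 0, 0) else 0) = 0"
  have "c (0, 0, \<zeta>) = 0" for \<zeta>
    using fun_cong[OF *, of "[]"] const by auto
  moreover have "c (r, j, \<zeta>) = 0" if "\<not> (r = 0 \<and> j = 0)" for r j \<zeta>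
    using that by (intro V_sum_component_zero[OF c]) auto
  ultimately have "c (r, j, \<zeta>) = 0" for r j \<zeta>
    by (cases "r = 0 \<and> j = 0") simp_all
  then show "c = 0" by (simp add: fun_eq_iff)
next
  fix \<omega> assume "\<omega> \<in> forms_on {} k"
  then have \<omega>: "alternating \<omega>" "homogeneous k \<omega>" "contract (e1 t) \<omega> = 0" "contract (e2 t) \<omega> = 0" for t
    by (auto simp: forms_on_def)
  have nz: "\<omega> vs = 0" if "vs \<noteq> []" for vs
    using that spanning[OF \<omega>(1,3,4)] by (cases vs) auto
  define c :: "nat \<times> nat \<times> (complex ^ 2) \<Rightarrow> complex"
    where "c = (\<lambda>(r, j, \<zeta>). if r = 0 \<and> j = 0 then \<omega> [] else 0)"
  have "\<omega> [] = 0" if "k \<noteq> 0"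
    using \<omega>(2) that by (simp add: homogeneous_def)
  moreover have "(\<lambda>\<zeta>. \<omega> []) \<in> V_carrier 0"
    by (auto simp: V_carrier_def)
  ultimately have "c \<in> V_sum_carrier UNIV (V_multiplicity 0 k)"
    by (intro V_sum_carrierI) (auto simp: c_def split: if_splits)
  moreover have "\<omega> = (\<lambda>vs. if vs = [] then c (0, 0, 0) else 0)"
    using nz by (auto simp: c_def)
  ultimately show "\<exists>c\<in>V_sum_carrier UNIV (V_multiplicity 0 k). \<omega> = (\<lambda>vs. if vs = [] then c (0, 0, 0) else 0)"
    by blast
qed (auto simp: fun_eq_iff)

text \<open>
  Sp(1) fixes \<open>\<beta>1 \<and> \<beta>2\<close> because \<open>su2 q\<close> has determinant 1, and \<open>\<beta>1, \<beta>2\<close> span a copy of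
  \<open>V\<^sub>1\<close>; so the three summands of \<open>forms_on_insert\<close> are covered by the closure properties of \<open>decomposes\<close>.
\<close>

lemma decomposes_forms_on: "decomposes act (V_multiplicity (card S) k) (forms_on S k)"
proof -
  have "finite S" by simp
  then have "\<forall>k. decomposes act (V_multiplicity (card S) k) (forms_on S k)"
  proof (induction S)
    case empty
    show ?case unfolding card.empty using decomposes_forms_on_empty by blast
  next
    case (insert t S)
    show ?case
    proof
      fix k
      let ?V = "forms_on S"
      have V: "decomposes act (V_multiplicity (card S) k) (?V k)" for k
        using insert.IH by blast
      note cd = contract_doublet[OF _ insert.hyps(2)]
      let ?B = "\<lambda>\<omega>. wedge (\<beta>1 t) (wedge (\<beta>2 t) \<omega>)"
      have B0: "f = 0" if "f \<in> ?V l" "wedge (\<beta>2 t) f = 0" for f l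
        using cd(4)[OF that(1)] that(2) by (simp add: contract_zero)
      have I: "decomposes act (V_multiplicity (card S) (k - 2)) (?B ` ?V (k - 2))"
      proof (rule decomposes_image[OF V])
        fix q f assume "q \<in> Sp1"
        then have "fst q * cnj (fst q) + snd q * cnj (snd q) = 1"
          using qmult_qcnj(1) by (simp add: qmult_def qcnj_def q_one_def)
        moreover have "act q (?B f) =
            fscale (fst q * cnj (fst q) + snd q * cnj (snd q)) (?B (act q f))"
          unfolding act_wedge[OF \<open>q \<in> Sp1\<close>] wedge_add wedge_scale wedge_self
            wedge_anticommute[of "\<beta>2 t" "\<beta>1 t"]
          by (simp add: fun_eq_iff algebra_simps)
        ultimately show "?B (act q f) = act q (?B f)"
          by (simp add: fun_eq_iff)
      next
        fix f assume f: "f \<in> ?V (k - 2)" "?B f = 0"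
        then have "wedge (\<beta>2 t) f = 0"
          using cd(5)[OF f(1)] by (simp add: contract_zero)
        then show "f = 0" using B0 f(1) by blast
      qed (simp_all add: wedge_add wedge_scale)
      have D: "decomposes act (\<lambda>r. V_multiplicity (card S) k r + V_multiplicity (card S) (k - 2) r)
          {f + g |f g. f \<in> ?V k \<and> g \<in> ?B ` ?V (k - 2)}"
      proof (rule decomposes_direct_sum[OF V I])
        show "?V k \<inter> ?B ` ?V (k - 2) \<subseteq> {0}"
        proof clarify
          fix c assume c: "?B c \<in> ?V k" "c \<in> ?V (k - 2)"
          have "wedge (\<beta>2 t) c = 0"
            using forms_on_contract_zero(1)[OF c(1) insert.hyps(2)] cd(5)[OF c(2)] by simp
          then show "?B c = 0" by (simp add: wedge_zero)
        qed
      qed (simp add: act_add)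
      have T: "decomposes act (tensor_V1_mult (V_multiplicity (card S) (k - 1)))
          {wedge (\<beta>1 t) f + wedge (\<beta>2 t) g |f g. f \<in> ?V (k - 1) \<and> g \<in> ?V (k - 1)}"
      proof (rule decomposes_tensor_V1[OF V])
        fix q f g assume "q \<in> Sp1"
        then show "act q (wedge (\<beta>1 t) f + wedge (\<beta>2 t) g) =
            wedge (\<beta>1 t) (fscale (fst q) (act q f) + fscale (snd q) (act q g)) +
            wedge (\<beta>2 t) (fscale (- cnj (snd q)) (act q f) + fscale (cnj (fst q)) (act q g))"
          by (simp add: act_add act_wedge wedge_add wedge_scale fun_eq_iff)
      next
        fix f g assume fg: "f \<in> ?V (k - 1)" "g \<in> ?V (k - 1)" "wedge (\<beta>1 t) f + wedge (\<beta>2 t) g = 0"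
        have "contract (e1 t) (wedge (\<beta>1 t) f + wedge (\<beta>2 t) g) = 0"
          "contract (e2 t) (wedge (\<beta>1 t) f + wedge (\<beta>2 t) g) = 0"
          by (simp_all add: fg contract_zero)
        then show "f = 0 \<and> g = 0"
          unfolding contract_add cd[OF fg(1)] cd[OF fg(2)] by simp
      qed (simp_all add: wedge_add wedge_scale)
      have "decomposes act (\<lambda>r. (V_multiplicity (card S) k r + V_multiplicity (card S) (k - 2) r)
          + tensor_V1_mult (V_multiplicity (card S) (k - 1)) r) (forms_on (insert t S) k)"
        unfolding forms_on_insert[OF insert.hyps(2)]
      proof (rule decomposes_direct_sum[OF D T])
        show "{f + g |f g. f \<in> ?V k \<and> g \<in> ?B ` ?V (k - 2)} \<inter>
          {wedge (\<beta>1 t) f + wedge (\<beta>2 t) g |f g. f \<in> ?V (k - 1) \<and> g \<in> ?V (k - 1)} \<subseteq> {0}"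
        proof clarify
          fix a c b1 b2
          assume *: "a \<in> ?V k" "c \<in> ?V (k - 2)" "b1 \<in> ?V (k - 1)" "b2 \<in> ?V (k - 1)"
            "a + ?B c = wedge (\<beta>1 t) b1 + wedge (\<beta>2 t) b2"
          note a0 = forms_on_contract_zero[OF *(1) insert.hyps(2)]
          note b0 = forms_on_contract_zero[OF *(3) insert.hyps(2)]
          have "contract (e1 t) (a + ?B c) = contract (e1 t) (wedge (\<beta>1 t) b1 + wedge (\<beta>2 t) b2)"
            "contract (e2 t) (a + ?B c) = contract (e2 t) (wedge (\<beta>1 t) b1 + wedge (\<beta>2 t) b2)"
            by (simp_all add: *(5))
          then have b: "b1 = wedge (\<beta>2 t) c" "b2 = fscale (-1) (wedge (\<beta>1 t) c)"
            unfolding contract_add a0 cd[OF *(2)] cd[OF *(3)] cd[OF *(4)] by simp_all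
          then have "c = 0"
            using cd(4)[OF *(2)] b0(2) by simp
          then have "b1 = 0" "b2 = 0"
            using b by (simp_all add: wedge_zero)
          then show "a + ?B c = 0"
            unfolding *(5) by (simp add: wedge_zero)
        qed
      qed (simp add: act_add)
      moreover have "(\<lambda>r. (V_multiplicity (card S) k r + V_multiplicity (card S) (k - 2) r)
          + tensor_V1_mult (V_multiplicity (card S) (k - 1)) r) = V_multiplicity (card (insert t S)) k"
        using insert.hyps by (simp add: fun_eq_iff)
      ultimately show "decomposes act (V_multiplicity (card (insert t S)) k) (forms_on (insert t S) k)"
        by simp
    qed
  qed
  then show ?thesis by blast
qed

lemma forms_on_UNIV: "forms_on UNIV k = {\<omega>. alternating \<omega> \<and> homogeneous k \<omega>}"
  by (simp add: forms_on_def)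

end

section \<open>The multiplicities in closed form\<close>

lemma zbinom_Suc: "zbinom (Suc N) q = zbinom N q + zbinom N (q - 1)"
proof (cases "q \<le> 0")
  case True
  then show ?thesis by (cases "q = 0") (simp_all add: zbinom_def)
next
  case False
  then obtain p where "nat q = Suc p" "nat (q - 1) = p"
    by (metis Suc_nat_eq_nat_zadd1 diff_add_cancel add.commute int_one_le_iff_zero_less
        linorder_not_le zle_diff1_eq)
  with False show ?thesis by (simp add: zbinom_def)
qed

text \<open>
  In the exterior algebra of \<open>N\<close> doublets, \<open>zbinom N a * zbinom N b\<close> is the dimension of the weight space of
  weight \<open>a - b\<close> in degree \<open>a + b\<close>: it is spanned by products of \<open>a\<close> covectors of weight 1 and \<open>b\<close> covectors
  of weight \<open>-1\<close>. The multiplicity of \<open>V\<^sub>r\<close> is the drop in dimension from weight \<open>r\<close> to \<open>r + 2\<close>.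
\<close>

definition weight_drop :: "nat \<Rightarrow> int \<Rightarrow> int \<Rightarrow> int" where
  "weight_drop N a b = zbinom N a * zbinom N b - zbinom N (a + 1) * zbinom N (b - 1)"

lemma weight_drop_Suc: "weight_drop (Suc N) a b = weight_drop N a b + weight_drop N (a - 1) (b - 1) + weight_drop N (a - 1) b + weight_drop N a (b - 1)"
  by (simp add: weight_drop_def zbinom_Suc algebra_simps)

text \<open>
  The case \<open>r = 0\<close>, in which there is no contribution from \<open>V\<^sub>r\<^sub>-\<^sub>1\<close>, is no exception because
  \<open>weight_drop N a b\<close> vanishes when \<open>a - b = - 1\<close>.
\<close>

lemma V_multiplicity_closed_form: "a - b = int r \<Longrightarrow> int (V_multiplicity N (a + b) r) = weight_drop N a b"
proof (induction N arbitrary: a b r)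
  case 0
  have "zbinom 0 q = (if q = 0 then 1 else 0)" for q
    by (cases "q \<le> 0") (auto simp: zbinom_def binomial_eq_0)
  with 0 show ?case by (auto simp: weight_drop_def)
next
  case (Suc N)
  have 1: "int (V_multiplicity N (a + b) r) = weight_drop N a b"
    using Suc by blast
  have 2: "int (V_multiplicity N (a + b - 2) r) = weight_drop N (a - 1) (b - 1)"
    using Suc.IH[of "a - 1" "b - 1" r] Suc.prems by (simp add: algebra_simps)
  have 3: "int (V_multiplicity N (a + b - 1) (Suc r)) = weight_drop N a (b - 1)"
    using Suc.IH[of a "b - 1" "Suc r"] Suc.prems by (simp add: algebra_simps)
  have 4: "int (case r of 0 \<Rightarrow> 0 | Suc s \<Rightarrow> V_multiplicity N (a + b - 1) s) = weight_drop N (a - 1) b"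
  proof (cases r)
    case 0
    then show ?thesis using Suc.prems by (simp add: weight_drop_def)
  next
    case (Suc s)
    then show ?thesis
      using Suc.IH[of "a - 1" b s] Suc.prems by (simp add: algebra_simps)
  qed
  show ?case
    using 1 2 3 4 by (simp add: weight_drop_Suc tensor_V1_mult_def)
qed

lemma V_multiplicity_odd: "\<not> even (k - int r) \<Longrightarrow> V_multiplicity N k r = 0"
proof (induction N arbitrary: k r)
  case (Suc N)
  have "(case r of 0 \<Rightarrow> 0 | Suc s \<Rightarrow> V_multiplicity N (k - 1) s) = 0"
    using Suc by (cases r) auto
  with Suc show ?case by (simp add: tensor_V1_mult_def)
next
  case 0
  then show ?case by (cases "r = 0") auto
qed

lemma V_multiplicity_above: "k < int r \<Longrightarrow> V_multiplicity N k r = 0"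
proof (induction N arbitrary: k r)
  case (Suc N)
  have "(case r of 0 \<Rightarrow> 0 | Suc s \<Rightarrow> V_multiplicity N (k - 1) s) = 0"
    using Suc by (cases r) auto
  with Suc show ?case by (simp add: tensor_V1_mult_def)
next
  case 0
  then show ?case by (cases "r = 0") auto
qed

section \<open>The doublets of quaternionic space\<close>

text \<open>
  The index \<open>(l, False)\<close> stands for the pair \<open>(cnj w, z)\<close> and \<open>(l, True)\<close> for \<open>(- cnj z, w)\<close>, where
  \<open>z + w j\<close> is the \<open>l\<close>-th quaternionic coordinate.
\<close>

definition doublet1 :: "'n \<times> bool \<Rightarrow> quat ^ 'n \<Rightarrow> complex" where
  "doublet1 t v = (if snd t then - cnj (fst (v $ fst t)) else cnj (snd (v $ fst t)))"

definition doublet2 :: "'n \<times> bool \<Rightarrow> quat ^ 'n \<Rightarrow> complex" where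
  "doublet2 t v = (if snd t then snd (v $ fst t) else fst (v $ fst t))"

text \<open>
  With \<open>x + \<i> y\<close> the complexified vector given by the pair \<open>(x, y)\<close>, a factor \<open>\<i>\<close> in \<open>y\<close> is multiplication
  by the quaternion \<open>\<i>\<close> in \<open>H\<close>, not by the scalar \<open>\<i>\<close> of the complexification. Thus \<open>z\<close> takes the value
  \<open>1/2 + \<i> (- \<i>/2) = 1\<close> on \<open>dual2 (l, False)\<close>, and \<open>cnj z\<close> the value \<open>1/2 + \<i> (\<i>/2) = 0\<close>.
\<close>

definition dual1 :: "'n::finite \<times> bool \<Rightarrow> (quat ^ 'n) \<times> (quat ^ 'n)" where
  "dual1 t = (if snd t then (axis (fst t) (- 1/2, 0), axis (fst t) (- \<i>/2, 0))
     else (axis (fst t) (0, 1/2), axis (fst t) (0, \<i>/2)))"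

definition dual2 :: "'n::finite \<times> bool \<Rightarrow> (quat ^ 'n) \<times> (quat ^ 'n)" where
  "dual2 t = (if snd t then (axis (fst t) (0, 1/2), axis (fst t) (0, - \<i>/2))
     else (axis (fst t) (1/2, 0), axis (fst t) (- \<i>/2, 0)))"

lemma real_part_imaginary_part_zero:
  "a + \<i> * b = 0 \<Longrightarrow> - a + \<i> * b = 0 \<Longrightarrow> a = 0 \<and> b = 0" for a b :: complex
  by (simp add: complex_eq_iff)

text \<open>
  In each coordinate the four dual vectors are complex combinations of the four real basis vectors, and conversely;
  so a form killed by them is killed by the real basis vectors.
\<close>

lemma doublet_duals_span:
  fixes \<omega> :: "(quat ^ 'n::finite) list \<Rightarrow> complex"
  assumes alt: "alternating \<omega>"
    and 1: "\<And>t. contract (dual1 t) \<omega> = 0" and 2: "\<And>t. contract (dual2 t) \<omega> = 0"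
  shows "\<omega> (v # vs) = 0"
proof -
  note D = alternatingD[OF alt, of "[]", unfolded append_Nil]
  define f where "f v = \<omega> (v # vs)" for v
  have lin: "linear f"
    by (rule linearI) (simp_all only: f_def D scaleR_conv_of_real)
  have c: "f (fst (dual1 t)) + \<i> * f (snd (dual1 t)) = 0" "f (fst (dual2 t)) + \<i> * f (snd (dual2 t)) = 0" for t
    using fun_cong[OF 1[of t], of vs] fun_cong[OF 2[of t], of vs]
    by (simp_all add: contract_def f_def)
  have neg: "f (- w) = - f w" for w
    using lin by (rule linear_neg)
  have twice: "f w = 0" if "f ((1/2) *\<^sub>R w) = 0" for w
    using that linear_cmul[OF lin, of "1/2" w] by simp
  have "f b = 0" if "b \<in> Basis" for b
  proof -
    from that obtain l p where b: "b = axis l p" "p \<in> Basis"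
      by (auto simp: Basis_vec_def)
    have eqs: "axis l (- z, 0) = - (axis l ((z, 0) :: quat) :: quat ^ 'n)"
      "axis l (0, - z) = - (axis l ((0, z) :: quat) :: quat ^ 'n)" for z :: complex
      by (simp_all add: vec_eq_iff axis_def zero_prod_def)
    have z: "f (axis l (1/2, 0)) = 0 \<and> - f (axis l (\<i>/2, 0)) = 0"
    proof (rule real_part_imaginary_part_zero)
      show "f (axis l (1/2, 0)) + \<i> * - f (axis l (\<i>/2, 0)) = 0"
        using c(2)[of "(l, False)"] by (simp add: dual2_def eqs neg)
      show "- f (axis l (1/2, 0)) + \<i> * - f (axis l (\<i>/2, 0)) = 0"
        using c(1)[of "(l, True)"] by (simp add: dual1_def eqs neg)
    qed
    have w: "f (axis l (0, 1/2)) = 0 \<and> f (axis l (0, \<i>/2)) = 0"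
    proof -
      have "f (axis l (0, 1/2)) + \<i> * f (axis l (0, \<i>/2)) = 0"
        "f (axis l (0, 1/2)) + \<i> * - f (axis l (0, \<i>/2)) = 0"
        using c(1)[of "(l, False)"] c(2)[of "(l, True)"] by (simp_all add: dual1_def dual2_def eqs neg)
      then show ?thesis by (simp add: complex_eq_iff)
    qed
    have "p = (1, 0) \<or> p = (\<i>, 0) \<or> p = (0, 1) \<or> p = (0, \<i>)"
      using b(2) by (auto simp: Basis_prod_def Basis_complex_def)
    moreover have "axis l (1/2, 0) = (1/2) *\<^sub>R (axis l ((1, 0) :: quat) :: quat ^ 'n)"
      "axis l (\<i>/2, 0) = (1/2) *\<^sub>R (axis l ((\<i>, 0) :: quat) :: quat ^ 'n)"
      "axis l (0, 1/2) = (1/2) *\<^sub>R (axis l ((0, 1) :: quat) :: quat ^ 'n)"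
      "axis l (0, \<i>/2) = (1/2) *\<^sub>R (axis l ((0, \<i>) :: quat) :: quat ^ 'n)"
      by (simp_all add: vec_eq_iff axis_def zero_prod_def scaleR_conv_of_real)
    ultimately show ?thesis
      using z w twice unfolding b by force
  qed
  then have "f = (\<lambda>_. 0)"
    by (intro linear_eq_stdbasis[OF lin linear_zero]) simp
  then show ?thesis by (simp add: f_def fun_eq_iff)
qed

interpretation Hn: doublets doublet1 doublet2 dual1 dual2 "\<lambda>q. qleft (qcnj q)"
proof
  show "alternating \<omega> \<Longrightarrow> (\<And>t. contract (dual1 t) \<omega> = 0) \<Longrightarrow> (\<And>t. contract (dual2 t) \<omega> = 0) \<Longrightarrow>
      \<omega> (v # vs) = 0" for \<omega> :: "(quat ^ 'n) list \<Rightarrow> complex" and v vs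
    by (rule doublet_duals_span)
qed (auto simp: doublet1_def doublet2_def dual1_def dual2_def axis_def qleft_def qmult_def qcnj_def
    scaleR_conv_of_real algebra_simps)

section \<open>Forms on a tangent space\<close>

lemma qleft_one: "qleft q_one h = h"
  by (simp add: qleft_def qmult_def q_one_def)

lemma qleft_qleft: "qleft p (qleft q h) = qleft (qmult p q) h"
  by (simp add: qleft_def qmult_def vec_eq_iff algebra_simps)

lemma qcnj_qmult: "qcnj (qmult p q) = qmult (qcnj q) (qcnj p)"
  by (simp add: qcnj_def qmult_def algebra_simps)

lemma qcnj_one: "qcnj q_one = q_one"
  by (simp add: qcnj_def q_one_def)

text \<open>
  What is used of a tangent space of a manifold: it is a real vector space with a linear isomorphism
  to \<open>H\<^sup>n\<close>. Alternating forms and the action of Sp(1) on them are transported along this isomorphism.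
\<close>

locale coframed_space =
  fixes T :: "('m, 'n::finite) tvec set" and u :: "('m, 'n) tvec \<Rightarrow> quat ^ 'n"
  assumes add_closed: "v \<in> T \<Longrightarrow> w \<in> T \<Longrightarrow> v + w \<in> T"
    and scale_closed: "v \<in> T \<Longrightarrow> tscale a v \<in> T"
    and coframe: "u \<in> coframes T"
begin

definition U :: "quat ^ 'n \<Rightarrow> ('m, 'n) tvec" where "U = inv_into T u"

lemma u_linear: "v \<in> T \<Longrightarrow> w \<in> T \<Longrightarrow> u (v + w) = u v + u w" "v \<in> T \<Longrightarrow> u (tscale a v) = a *\<^sub>R u v"
  using coframe by (auto simp: coframes_def)

lemma u_bij: "bij_betw u T UNIV"
  using coframe by (simp add: coframes_def)

lemma U_in [simp]: "U h \<in> T"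
  using u_bij unfolding U_def bij_betw_def by (metis inv_into_into UNIV_I)

lemma u_U [simp]: "u (U h) = h"
  using u_bij unfolding U_def bij_betw_def by (metis f_inv_into_f UNIV_I)

lemma U_u: "v \<in> T \<Longrightarrow> U (u v) = v"
  using u_bij unfolding U_def bij_betw_def by (metis inv_into_f_f)

lemma U_linear: "U (h + h') = U h + U h'" "U (a *\<^sub>R h) = tscale a (U h)"
  using U_u[of "U h + U h'"] U_u[of "tscale a (U h)"]
  by (simp_all add: u_linear add_closed scale_closed)

lemma tangent_action_eq: "tangent_action T u q v = U (qleft q (u v))"
  by (simp add: tangent_action_def U_def)

definition pullback :: "((quat ^ 'n) list \<Rightarrow> complex) \<Rightarrow> ('m, 'n) tvec list \<Rightarrow> complex" where
  "pullback \<eta> vs = (if set vs \<subseteq> T then \<eta> (map u vs) else 0)"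

lemma pullback_in_complex_forms:
  assumes "\<eta> \<in> Hn.forms_on UNIV (int k)"
  shows "pullback \<eta> \<in> complex_forms k T"
proof -
  have \<eta>: "alternating \<eta>" "homogeneous (int k) \<eta>"
    using assms by (simp_all add: Hn.forms_on_UNIV)
  have upd: "vs[i := v] = take i vs @ v # drop (Suc i) vs" if "i < length vs" for vs and v :: "('m, 'n) tvec" and i
    using that by (rule upd_conv_take_nth_drop)
  have sub: "set (take i vs) \<subseteq> T" "set (drop i vs) \<subseteq> T" if "set vs \<subseteq> T" for vs and i
    using that set_take_subset[of i vs] set_drop_subset[of i vs] by blast+
  have "pullback \<eta> vs = 0" if "\<not> (length vs = k \<and> set vs \<subseteq> T)" for vs
    using \<eta>(2) that by (auto simp: pullback_def homogeneous_def)
  moreover have "pullback \<eta> (vs[i := v + w]) = pullback \<eta> (vs[i := v]) + pullback \<eta> (vs[i := w])"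
    if "length vs = k \<and> set vs \<subseteq> T \<and> i < k \<and> v \<in> T \<and> w \<in> T" for vs i v w
    using that by (simp add: upd pullback_def sub add_closed u_linear alternatingD(1)[OF \<eta>(1)])
  moreover have "pullback \<eta> (vs[i := tscale a v]) = of_real a * pullback \<eta> (vs[i := v])"
    if "length vs = k \<and> set vs \<subseteq> T \<and> i < k \<and> v \<in> T" for vs i v a
    using that by (simp add: upd pullback_def sub scale_closed u_linear alternatingD(2)[OF \<eta>(1)])
  moreover have "pullback \<eta> vs = 0"
    if "length vs = k \<and> set vs \<subseteq> T \<and> i < j \<and> j < k \<and> vs ! i = vs ! j" for vs i j
  proof -
    define as bs cs where "as = take i vs" and "bs = take (j - Suc i) (drop (Suc i) vs)"
      and "cs = drop (Suc (j - Suc i)) (drop (Suc i) vs)"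
    have "drop (Suc i) vs = bs @ vs ! i # cs"
      unfolding bs_def cs_def
      using that id_take_nth_drop[of "j - Suc i" "drop (Suc i) vs"] diff_less_mono[of j k "Suc i"]
      by simp
    moreover have "vs = as @ vs ! i # drop (Suc i) vs"
      unfolding as_def using that by (intro id_take_nth_drop) simp
    ultimately have "vs = as @ vs ! i # bs @ vs ! i # cs"
      by simp
    then have "map u vs = map u as @ u (vs ! i) # map u bs @ u (vs ! i) # map u cs"
      by (metis list.simps(9) map_append)
    then show ?thesis
      using alternating_repeated[OF \<eta>(1)] by (simp add: pullback_def)
  qed
  ultimately show ?thesis
    unfolding complex_forms_def by blast
qed

lemma complex_forms_subset_pullback:
  assumes "\<omega> \<in> complex_forms k T"
  shows "\<exists>\<eta>\<in>Hn.forms_on UNIV (int k). \<omega> = pullback \<eta>"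
proof -
  have \<omega>: "\<And>vs. \<not> (length vs = k \<and> set vs \<subseteq> T) \<Longrightarrow> \<omega> vs = 0"
    "\<And>vs i v w. length vs = k \<Longrightarrow> set vs \<subseteq> T \<Longrightarrow> i < k \<Longrightarrow> v \<in> T \<Longrightarrow> w \<in> T \<Longrightarrow>
        \<omega> (vs[i := v + w]) = \<omega> (vs[i := v]) + \<omega> (vs[i := w])"
    "\<And>vs i v a. length vs = k \<Longrightarrow> set vs \<subseteq> T \<Longrightarrow> i < k \<Longrightarrow> v \<in> T \<Longrightarrow>
        \<omega> (vs[i := tscale a v]) = of_real a * \<omega> (vs[i := v])"
    "\<And>vs i j. length vs = k \<Longrightarrow> set vs \<subseteq> T \<Longrightarrow> i < j \<Longrightarrow> j < k \<Longrightarrow> vs ! i = vs ! j \<Longrightarrow> \<omega> vs = 0"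
    using assms unfolding complex_forms_def by blast+
  define \<eta> where "\<eta> hs = \<omega> (map U hs)" for hs
  have range: "set (map U hs) \<subseteq> T" for hs by auto
  have "alternating \<eta>"
  proof (rule alternatingI)
    fix us vs and v w :: "quat ^ 'n" and a :: real
    let ?xs = "map U (us @ v # vs)"
    have upd: "map U us @ z # map U vs = ?xs[length us := z]" for z
      using list_update_length[of "map U us" "U v" "map U vs" z] by simp
    show "\<eta> (us @ (v + w) # vs) = \<eta> (us @ v # vs) + \<eta> (us @ w # vs)"
    proof (cases "length ?xs = k")
      case True
      then show ?thesis
        unfolding \<eta>_def map_append list.map U_linear unfolding upd
        by (intro \<omega>(2)[OF True range]) (use True in auto)
    qed (simp add: \<eta>_def \<omega>(1))
    show "\<eta> (us @ (a *\<^sub>R v) # vs) = of_real a * \<eta> (us @ v # vs)"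
    proof (cases "length ?xs = k")
      case True
      then show ?thesis
        unfolding \<eta>_def map_append list.map U_linear unfolding upd
        by (intro \<omega>(3)[OF True range]) (use True in auto)
    qed (simp add: \<eta>_def \<omega>(1))
    show "\<eta> (us @ v # v # vs) = 0"
    proof (cases "length (map U (us @ v # v # vs)) = k")
      case True
      then show ?thesis
        using \<omega>(4)[OF True range, of "length us" "Suc (length us)"]
        by (simp add: \<eta>_def nth_append)
    qed (simp add: \<eta>_def \<omega>(1))
  qed
  moreover have "homogeneous (int k) \<eta>"
    by (simp add: homogeneous_def \<eta>_def \<omega>(1))
  moreover have "pullback \<eta> vs = \<omega> vs" for vs
  proof (cases "set vs \<subseteq> T")
    case True
    then have "map (\<lambda>v. U (u v)) vs = vs"
      by (intro map_idI) (auto simp: U_u)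
    with True show ?thesis by (simp add: pullback_def \<eta>_def comp_def)
  next
    case False
    then show ?thesis by (simp add: pullback_def \<omega>(1))
  qed
  ultimately show ?thesis
    by (intro bexI[of _ \<eta>]) (auto simp: Hn.forms_on_UNIV)
qed

lemma decomposes_complex_forms:
  "decomposes (form_action T u) (V_multiplicity (2 * CARD('n)) (int k)) (complex_forms k T)"
proof -
  have "decomposes (form_action T u) (V_multiplicity (card (UNIV :: ('n \<times> bool) set)) (int k))
      (pullback ` Hn.forms_on UNIV (int k))"
  proof (rule decomposes_image[OF Hn.decomposes_forms_on])
    show "pullback (f + g) = pullback f + pullback g" "pullback (fscale a f) = fscale a (pullback f)" for f g a
      by (auto simp: fun_eq_iff pullback_def)
    show "pullback (Hn.act q f) = form_action T u q (pullback f)" for q f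
      by (auto simp: fun_eq_iff pullback_def Hn.act_def form_action_def tangent_action_eq comp_def)
    show "f = 0" if "pullback f = 0" for f
    proof
      fix hs
      have "pullback f (map U hs) = f hs"
        by (auto simp: pullback_def comp_def)
      then show "f hs = 0 hs" using that by simp
    qed
  qed
  moreover have "pullback ` Hn.forms_on UNIV (int k) = complex_forms k T"
    using pullback_in_complex_forms complex_forms_subset_pullback by blast
  moreover have "card (UNIV :: ('n \<times> bool) set) = 2 * CARD('n)"
    by simp
  ultimately show ?thesis by (simp only:)
qed

lemma Sp1_rep_complex_forms: "Sp1_rep (complex_forms k T) (form_action T u)"
proof -
  note closed = decomposes_subspace[OF decomposes_complex_forms[of k]]
  have "form_action T u (qmult q q') \<omega> = form_action T u q (form_action T u q' \<omega>)" for q q' \<omega>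
    by (auto simp: fun_eq_iff form_action_def tangent_action_eq[abs_def] comp_def qcnj_qmult qleft_qleft)
  moreover have "form_action T u q_one \<omega> = \<omega>" if "\<omega> \<in> complex_forms k T" for \<omega>
  proof
    fix vs
    show "form_action T u q_one \<omega> vs = \<omega> vs"
    proof (cases "set vs \<subseteq> T")
      case True
      then have "map (tangent_action T u (qcnj q_one)) vs = vs"
        by (intro map_idI) (auto simp: tangent_action_eq qcnj_one qleft_one U_u)
      with True show ?thesis by (simp add: form_action_def)
    next
      case False
      then show ?thesis using that by (auto simp: form_action_def complex_forms_def)
    qed
  qed
  moreover have "form_action T u q (f + g) = form_action T u q f + form_action T u q g"
    "form_action T u q (fscale a f) = fscale a (form_action T u q f)" for q f g a
    by (auto simp: fun_eq_iff form_action_def)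
  ultimately show ?thesis
    unfolding Sp1_rep_def subspace_fscale using closed by blast
qed

end

text \<open>
  The defining relations of a tangent vector are linear because transition maps are differentiable,
  which makes their Frechet derivatives linear.
\<close>

lemma tangent_space_closed:
  assumes "smooth_manifold X \<A>" "v \<in> tangent_space \<A> x"
  shows "w \<in> tangent_space \<A> x \<Longrightarrow> v + w \<in> tangent_space \<A> x" "tscale a v \<in> tangent_space \<A> x"
proof -
  have lin: "linear (frechet_derivative (transition c c') (at (snd c x)))"
    if "c \<in> \<A>" "c' \<in> \<A>" "x \<in> fst c \<inter> fst c'" for c c'
  proof -
    have "Ck_on (Suc 0) (transition c c') (snd c ` (fst c \<inter> fst c'))"
      using assms(1) that unfolding smooth_manifold_def smooth_on_def by blast
    then show ?thesis
      using that by (intro linear_frechet_derivative) auto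
  qed
  have tangent: "z c = 0" if "z \<in> tangent_space \<A> x" "c \<notin> \<A> \<or> x \<notin> fst c" for z c
    using that unfolding tangent_space_def by blast
  have related: "z c' = frechet_derivative (transition c c') (at (snd c x)) (z c)"
    if "z \<in> tangent_space \<A> x" "c \<in> \<A>" "c' \<in> \<A>" "x \<in> fst c \<inter> fst c'" for z c c'
    using that unfolding tangent_space_def by blast
  show "v + w \<in> tangent_space \<A> x" if w: "w \<in> tangent_space \<A> x"
    unfolding tangent_space_def
  proof (intro CollectI conjI allI impI ballI)
    fix c assume "c \<notin> \<A> \<or> x \<notin> fst c"
    then show "(v + w) c = 0"
      using tangent[OF assms(2)] tangent[OF w] by simp
  next
    fix c c' assume c: "c \<in> \<A>" "c' \<in> \<A>" "x \<in> fst c \<inter> fst c'"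
    show "(v + w) c' = frechet_derivative (transition c c') (at (snd c x)) ((v + w) c)"
      unfolding plus_fun_apply linear_add[OF lin[OF c]] related[OF assms(2) c] related[OF w c] ..
  qed
  show "tscale a v \<in> tangent_space \<A> x"
    unfolding tangent_space_def
  proof (intro CollectI conjI allI impI ballI)
    fix c assume "c \<notin> \<A> \<or> x \<notin> fst c"
    then show "tscale a v c = 0"
      using tangent[OF assms(2)] by (simp add: tscale_def)
  next
    fix c c' assume c: "c \<in> \<A>" "c' \<in> \<A>" "x \<in> fst c \<inter> fst c'"
    show "tscale a v c' = frechet_derivative (transition c c') (at (snd c x)) (tscale a v c)"
      unfolding tscale_def linear_cmul[OF lin[OF c]] related[OF assms(2) c] ..
  qed
qed

theorem proposition4p1:
  fixes X :: "'m topology"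
    and \<A> :: "('m, 'n::finite) chart set"
    and Q :: "'m \<Rightarrow> (('m, 'n) tvec \<Rightarrow> quat ^ 'n) set"
    and k n :: nat
  assumes "n = CARD('n)"
    and "quaternionic_manifold X \<A> Q"
    and "k \<le> 4 * n"
  shows "\<exists>m :: nat \<Rightarrow> nat.
    (\<forall>r \<in> {r. r \<le> k \<and> r mod 2 = k mod 2}.
       int (m r) =
         zbinom (2 * n) ((int k + int r) div 2) * zbinom (2 * n) ((int k - int r) div 2)
         - zbinom (2 * n) ((int k + int r + 2) div 2) * zbinom (2 * n) ((int k - int r - 2) div 2)) \<and>
    (\<forall>x \<in> topspace X. \<forall>u \<in> Q x.
       Sp1_isomorphic
         (complex_forms k (tangent_space \<A> x)) (form_action (tangent_space \<A> x) u)
         (V_sum_carrier {r. r \<le> k \<and> r mod 2 = k mod 2} m) V_sum_action)"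
proof (intro exI[of _ "V_multiplicity (2 * n) (int k)"] conjI ballI)
  let ?R = "{r. r \<le> k \<and> r mod 2 = k mod 2}" and ?m = "V_multiplicity (2 * n) (int k)"
  fix r assume "r \<in> ?R"
  then have "r \<le> k" "2 dvd k - r"
    using mod_eq_dvd_iff_nat[of r k 2] by auto
  then obtain b where b: "k = r + 2 * b"
    by (metis dvdE le_add_diff_inverse)
  show "int (?m r) =
         zbinom (2 * n) ((int k + int r) div 2) * zbinom (2 * n) ((int k - int r) div 2)
         - zbinom (2 * n) ((int k + int r + 2) div 2) * zbinom (2 * n) ((int k - int r - 2) div 2)"
  proof -
    have "(int k + int r) div 2 = int r + int b" "(int k - int r) div 2 = int b"
      "(int k + int r + 2) div 2 = int r + int b + 1" "(int k - int r - 2) div 2 = int b - 1"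
      "int r + int b + int b = int k"
      using b by simp_all
    then show ?thesis
      using V_multiplicity_closed_form[of "int r + int b" "int b" r "2 * n"] by (simp add: weight_drop_def)
  qed
next
  let ?R = "{r. r \<le> k \<and> r mod 2 = k mod 2}" and ?m = "V_multiplicity (2 * n) (int k)"
  fix x u assume x: "x \<in> topspace X" "u \<in> Q x"
  have M: "smooth_manifold X \<A>" "u \<in> coframes (tangent_space \<A> x)"
    using assms(2) x unfolding quaternionic_manifold_def Sp1GLnH_structure_def by blast+
  interpret coframed_space "tangent_space \<A> x" u
    using tangent_space_closed[OF M(1)] M(2) by unfold_locales
  have "r \<in> ?R" if "?m r \<noteq> 0" for r
  proof -
    have "even (int k - int r)"
      by (rule contrapos_np[OF that V_multiplicity_odd])
    moreover have "\<not> int k < int r"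
      by (rule contrapos_nn[OF that V_multiplicity_above])
    ultimately have "r \<le> k \<and> r mod 2 = k mod 2"
      by presburger
    then show ?thesis by simp
  qed
  then have "r \<in> ?R \<and> j < ?m r \<longleftrightarrow> r \<in> UNIV \<and> j < ?m r" for r j
    by (cases "?m r = 0") auto
  then have "V_sum_carrier UNIV ?m = V_sum_carrier ?R ?m"
    unfolding V_sum_carrier_def by (simp only:)
  then show "Sp1_isomorphic
         (complex_forms k (tangent_space \<A> x)) (form_action (tangent_space \<A> x) u)
         (V_sum_carrier ?R ?m) V_sum_action"
    using decomposes_Sp1_isomorphic[OF decomposes_complex_forms Sp1_rep_complex_forms, of k]
    by (simp add: assms(1))
qed

end
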